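(* Let $\mu$ be the probability measure $\mu(\mathrm{d}x)=Z_\mu^{-1}\mathrm{e}^{-U(x)}\,\mathrm{d}x$ on $\mathbb{R}^n$ described in the context, with $V$ $\rho$-convex, $\rho>0$. For every Lipschitz function $F:\mathbb{R}^n\to\mathbb{R}$ and every real $r>0$, $$\mu\left(\left|F-\int F\,\mathrm{d}\mu\right|\geq r\right)\leq 2\exp\left(-\frac{\rho}{\|F\|_{\mathrm{Lip}}^2}\frac{r^2}{2}\right).$$ In particular, for any measurable $f:\mathbb{R}\to\mathbb{R}$ and all $r>0$, with $L_n(f)(x)=\frac1n\sum_{i=1}^n f(x_i)$, $$\mu\left(\left|L_n(f)-\int L_n(f)\,\mathrm{d}\mu\right|\geq r\right)\leq 2\exp\left(-n\frac{\rho}{\|f\|_{\mathrm{Lip}}^2}\frac{r^2}{2}\right).$$ Additionally, for all $r>0$, $$\mu\left(\left|x_1-\int x_1\,\mu(\mathrm{d}x)\right|\geq r\right)\leq 2\exp\left(-\rho\frac{r^2}{2}\right).$$ This holds in particular with $\rho=n$ for the beta Hermite ensemble, for all $\beta>0$.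
   Context: Let $n\geq 1$ be an integer and $|\cdot|$ the Euclidean norm on $\mathbb{R}^n$. For $\rho\in\mathbb{R}$, a function $\phi:\mathbb{R}^n\to\mathbb{R}\cup\{+\infty\}$ is called $\rho$-convex when $x\mapsto \phi(x)-\rho|x|^2/2$ is convex. Setting: $V:\mathbb{R}^n\to\mathbb{R}$ is $\rho$-convex for some $\rho>0$; $W:\mathbb{R}\to\mathbb{R}\cup\{+\infty\}$ is convex with domain $(0,+\infty)$, i.e. $W$ is finite on $(0,+\infty)$ and $W\equiv+\infty$ on $(-\infty,0]$. Set $U(x)=V(x)+\sum_{i<j}W(x_i-x_j)\in\mathbb{R}\cup\{+\infty\}$, which is finite exactly on $D=\{x\in\mathbb{R}^n: x_1>\cdots>x_n\}$. Assume $Z_\mu=\int_{\mathbb{R}^n}\mathrm{e}^{-U(x)}\,\mathrm{d}x<\infty$ and let $\mu$ be the probability measure with density $\mathrm{e}^{-U}/Z_\mu$ with respect to Lebesgue measure. In the last inequality $x_1$ denotes the first coordinate function on $\mathbb{R}^n$. Beta Hermite ensemble ($\beta>0$): the case $V(x)=\frac n2|x|^2$, $W(u)=-\beta\log u$ for $u>0$ and $W(u)=+\infty$ for $u\le 0$, i.e. $\mathrm{d}\mu(x)=Z_\mu^{-1}\mathrm{e}^{-\frac n2|x|^2}\prod_{i<j}(x_i-x_j)^\beta\,\mathbf{1}_{\{x_1\geq\cdots\geq x_n\}}\,\mathrm{d}x$. $\|\cdot\|_{\mathrm{Lip}}\in[0,+\infty]$ denotes the best Lipschitz constant with respect to the Euclidean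 norm ($+\infty$ if the function is not Lipschitz). If it equals $+\infty$ the exponential on the right-hand side is read as $1$, and if it equals $0$ the exponential is read as $0$. *)

theory Defs
  imports "HOL-Probability.Probability"
begin

definition ext_convex :: "('a::real_vector \<Rightarrow> ereal) \<Rightarrow> bool" where
  "ext_convex \<phi> \<longleftrightarrow>
     (\<forall>x. \<phi> x \<noteq> -\<infinity>) \<and>
     (\<forall>x y. \<forall>t\<in>{0<..<1}.
        \<phi> ((1 - t) *\<^sub>R x + t *\<^sub>R y) \<le> ereal (1 - t) * \<phi> x + ereal t * \<phi> y)"

definition rho_convex :: "real \<Rightarrow> ('a::real_inner \<Rightarrow> ereal) \<Rightarrow> bool" where
  "rho_convex \<rho> \<phi> \<longleftrightarrow> ext_convex (\<lambda>x. \<phi> x - ereal (\<rho> * (norm x)\<^sup>2 / 2))"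

text \<open>
  Coordinates are indexed by a finite linearly ordered type, so that \<open>i < j\<close> and the
  first coordinate \<open>x $ Min UNIV\<close> make sense; the dimension is \<open>CARD('n)\<close>.
\<close>

definition energy :: "(real ^ 'n::{finite,linorder} \<Rightarrow> real) \<Rightarrow> (real \<Rightarrow> ereal) \<Rightarrow> real ^ 'n::{finite,linorder} \<Rightarrow> ereal" where
  "energy V W x = ereal (V x) + (\<Sum>(i, j)\<in>{(i::'n, j). i < j}. W (x $ i - x $ j))"

text \<open>\<open>exp_neg u\<close> is $e^{-u}$, with $e^{-\infty} = 0$.\<close>

definition exp_neg :: "ereal \<Rightarrow> ennreal" where
  "exp_neg u = (case u of ereal r \<Rightarrow> ennreal (exp (- r)) | PInfty \<Rightarrow> 0 | MInfty \<Rightarrow> \<infinity>)"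

definition partition_fn :: "(real ^ 'n::{finite,linorder} \<Rightarrow> real) \<Rightarrow> (real \<Rightarrow> ereal) \<Rightarrow> ennreal" where
  "partition_fn V W = (\<integral>\<^sup>+ x. exp_neg (energy V W x) \<partial>lborel)"

definition gibbs :: "(real ^ 'n::{finite,linorder} \<Rightarrow> real) \<Rightarrow> (real \<Rightarrow> ereal) \<Rightarrow> (real ^ 'n::{finite,linorder}) measure" where
  "gibbs V W = density lborel (\<lambda>x. exp_neg (energy V W x) / partition_fn V W)"

definition gibbs_setting ::
  "real \<Rightarrow> (real ^ 'n::{finite,linorder} \<Rightarrow> real) \<Rightarrow> (real \<Rightarrow> ereal) \<Rightarrow> bool" where
  "gibbs_setting \<rho> V W \<longleftrightarrow>
     \<rho> > 0 \<and> rho_convex \<rho> (\<lambda>x. ereal (V x)) \<and>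
     ext_convex W \<and> {u. W u < \<infinity>} = {0<..} \<and>
     partition_fn V W < \<infinity>"

definition hermite_V :: "real ^ 'n::{finite,linorder} \<Rightarrow> real" where
  "hermite_V x = real CARD('n) / 2 * (norm x)\<^sup>2"

definition hermite_W :: "real \<Rightarrow> real \<Rightarrow> ereal" where
  "hermite_W \<beta> u = (if u > 0 then ereal (- \<beta> * ln u) else \<infinity>)"

text \<open>The best Lipschitz constant; the infimum of the empty set is \<open>\<infinity> :: ennreal\<close>.\<close>

definition lip_norm :: "('a::metric_space \<Rightarrow> 'b::metric_space) \<Rightarrow> ennreal" where
  "lip_norm f = Inf {ennreal C | C. C-lipschitz_on UNIV f}"

text \<open>
  \<open>gauss_exp c L r\<close> is $\exp(-\frac{c}{L^2}\frac{r^2}{2})$, read as $1$ for $L = \infty$ and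
  as $0$ for $L = 0$.
\<close>

definition gauss_exp :: "real \<Rightarrow> ennreal \<Rightarrow> real \<Rightarrow> real" where
  "gauss_exp c L r =
     (if L = \<infinity> then 1 else if L = 0 then 0 else exp (- (c / (enn2real L)\<^sup>2 * (r\<^sup>2 / 2))))"

definition empirical_mean :: "(real \<Rightarrow> real) \<Rightarrow> real ^ 'n::finite \<Rightarrow> real" where
  "empirical_mean f x = (\<Sum>i\<in>UNIV. f (x $ i)) / real CARD('n)"

end

theory Submission
  imports Defs
begin

text \<open>
  On the open chamber \<open>x\<^sub>1 > \<dots> > x\<^sub>n\<close> the interaction energy is a sum of convex functions of linear
  forms, so \<open>U\<close> inherits from \<open>V\<close> the strong convexity
  \<open>U (t x + (1 - t) y) \<le> t U x + (1 - t) U y - \<rho> t (1 - t) |x - y|\<^sup>2 / 2\<close>, and \<open>U = \<infinity>\<close> off the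
  chamber does no harm. Everything about concentration follows from this inequality for the density
  \<open>q = exp (- U) / Z\<close>.

  The engine is the Prekopa--Leindler inequality with unequal weights \<open>t\<close> and \<open>s = 1 - t\<close>. For an
  \<open>L\<close>-Lipschitz \<open>G\<close> with mean zero it is applied to the three functions
  \[ \exp\Big(G - \frac{L^2}{2 s \rho}\Big)\, q, \qquad \exp\Big(-\frac{t}{s} G\Big)\, q, \qquad q. \]
  The pointwise hypothesis holds because \<open>G x - G y \<le> L |x - y|\<close> is absorbed, by completing the
  square, in the term \<open>s \<rho> |x - y|\<^sup>2 / 2\<close> supplied by strong convexity. By Jensen's
  inequality the second integral is at least \<open>1\<close>, and the third equals \<open>1\<close>, so the first one is at most
  \<open>1\<close>. Letting \<open>s\<close> tend to \<open>1\<close> gives the sharp Laplace bound \<open>E exp G \<le> exp (L\<^sup>2 / (2 \<rho>))\<close>, from which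
  Chernoff's method yields the tail bounds with the stated constant. Equal weights \<open>t = s = 1/2\<close> would lose a factor
  \<open>2\<close> in the exponent, but they show first that \<open>exp G\<close> is integrable for every Lipschitz \<open>G\<close>.

  Prekopa--Leindler itself is proved on the line by comparing level sets with the
  Brunn--Minkowski inequality \<open>|A + B| \<ge> |A| + |B|\<close>, and then tensorized one coordinate at a time.

  The remaining statements are instances. The empirical mean of an \<open>L\<close>-Lipschitz function is
  \<open>L / \<surd>n\<close>-Lipschitz by the Cauchy--Schwarz inequality, which produces the additional factor \<open>n\<close>; a
  coordinate is \<open>1\<close>-Lipschitz; and in the beta Hermite case the one substantial point is that the
  partition function is finite, the Gaussian factor dominating the Vandermonde power.
\<close>

section \<open>The one-dimensional Brunn--Minkowski inequality\<close>

lemma emeasure_lborel_translate: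
  fixes A :: "'a::euclidean_space set"
  assumes "A \<in> sets borel"
  shows "emeasure lborel {x. x - c \<in> A} = emeasure lborel A"
proof -
  have "emeasure lborel A = emeasure (distr lborel borel ((+) (- c))) A"
    by (simp add: lborel_distr_plus)
  also have "\<dots> = emeasure lborel {x. x - c \<in> A}"
    using assms by (subst emeasure_distr) (auto simp: vimage_def)
  finally show ?thesis by simp
qed

lemma emeasure_lborel_dilate:
  fixes A :: "real set"
  assumes [measurable]: "A \<in> sets borel" and c: "c > 0"
  shows "emeasure lborel {x. x / c \<in> A} = ennreal c * emeasure lborel A"
proof -
  have [measurable]: "{x. x / c \<in> A} \<in> sets borel" by measurable
  have "emeasure lborel {x. x / c \<in> A} = (\<integral>\<^sup>+x. indicator {x. x / c \<in> A} x \<partial>lborel)"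
    by simp
  also have "\<dots> = ennreal \<bar>c\<bar> * (\<integral>\<^sup>+x. indicator {x. x / c \<in> A} (0 + c * x) \<partial>lborel)"
    by (rule nn_integral_real_affine) (use c in auto)
  also have "(\<integral>\<^sup>+x. indicator {x. x / c \<in> A} (0 + c * x) \<partial>lborel) = (\<integral>\<^sup>+x. indicator A x \<partial>lborel)"
    by (intro nn_integral_cong) (use c in \<open>auto simp: indicator_def\<close>)
  finally show ?thesis using c by simp
qed

text \<open>
  Take \<open>a0 \<in> A\<close> near the top of \<open>A\<close> and \<open>b0 \<in> B\<close> near the bottom of \<open>B\<close>. The translates \<open>A + b0\<close> and
  \<open>a0 + B\<close> both lie in \<open>A + B\<close>, and the first ends about where the second begins, so that they overlap
  only in a short interval. A superset \<open>C\<close> replaces the sumset, which may fail to be Borel.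
\<close>

lemma brunn_minkowski_real_bounded:
  fixes A B C :: "real set"
  assumes [measurable]: "A \<in> sets borel" "B \<in> sets borel" "C \<in> sets borel"
    and ne: "A \<noteq> {}" "B \<noteq> {}" and bd: "bounded A" "bounded B"
    and sum: "\<And>a b. a \<in> A \<Longrightarrow> b \<in> B \<Longrightarrow> a + b \<in> C"
  shows "emeasure lborel A + emeasure lborel B \<le> emeasure lborel C"
proof (rule ennreal_le_epsilon)
  fix e :: real assume e: "e > 0"
  have bA: "bdd_above A" and bB: "bdd_below B"
    using bd by (auto simp: bounded_imp_bdd_above bounded_imp_bdd_below)
  obtain a0 where a0: "a0 \<in> A" "Sup A - e/2 < a0"
    using less_cSupD[OF ne(1), of "Sup A - e/2"] e by auto
  obtain b0 where b0: "b0 \<in> B" "b0 < Inf B + e/2"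
    using cInf_lessD[OF ne(2), of "Inf B + e/2"] e by auto
  define A' where "A' = {x. x - b0 \<in> A}"
  define B' where "B' = {x. x - a0 \<in> B}"
  have [measurable]: "A' \<in> sets borel" "B' \<in> sets borel"
    unfolding A'_def B'_def by measurable
  have sub: "A' \<union> B' \<subseteq> C"
    using sum[OF _ b0(1)] sum[OF a0(1)] by (force simp: A'_def B'_def)
  have cap: "A' \<inter> B' \<subseteq> {a0 + Inf B .. Sup A + b0}"
  proof
    fix x assume "x \<in> A' \<inter> B'"
    then have "x - b0 \<le> Sup A" "Inf B \<le> x - a0"
      using cSup_upper[OF _ bA] cInf_lower[OF _ bB] by (auto simp: A'_def B'_def)
    then show "x \<in> {a0 + Inf B .. Sup A + b0}" by auto
  qed
  have "emeasure lborel A + emeasure lborel B = emeasure lborel A' + emeasure lborel B'"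
    by (simp add: A'_def B'_def emeasure_lborel_translate)
  also have "\<dots> = emeasure lborel (A' \<union> B') + emeasure lborel (A' \<inter> B')"
    by (rule emeasure_Un_Int) auto
  also have "\<dots> \<le> emeasure lborel C + emeasure lborel {a0 + Inf B .. Sup A + b0}"
    by (intro add_mono emeasure_mono sub cap) auto
  also have "emeasure lborel {a0 + Inf B .. Sup A + b0} \<le> ennreal e"
    using a0(2) b0(2) e by (auto simp: emeasure_lborel_Icc_eq intro!: ennreal_leI)
  finally show "emeasure lborel A + emeasure lborel B \<le> emeasure lborel C + ennreal e"
    by (simp add: add_left_mono order.trans)
qed

text \<open>
  The bounded case passes to the limit along the sections with \<open>[- n, n]\<close>; the sections have to be
  nonempty, hence \<open>n\<close> is taken large.
\<close>

lemma brunn_minkowski_real: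
  fixes A B C :: "real set"
  assumes [measurable]: "A \<in> sets borel" "B \<in> sets borel" "C \<in> sets borel"
    and ne: "A \<noteq> {}" "B \<noteq> {}"
    and sum: "\<And>a b. a \<in> A \<Longrightarrow> b \<in> B \<Longrightarrow> a + b \<in> C"
  shows "emeasure lborel A + emeasure lborel B \<le> emeasure lborel C"
proof -
  have lim: "(\<lambda>n. emeasure lborel (X \<inter> {- real n..real n})) \<longlonglongrightarrow> emeasure lborel X"
    if [measurable]: "X \<in> sets borel" for X
  proof -
    have "(\<Union>n. X \<inter> {- real n..real n}) = X"
    proof safe
      fix x assume "x \<in> X"
      obtain n where "\<bar>x\<bar> \<le> real n" using real_arch_simple by blast
      then show "x \<in> (\<Union>n. X \<inter> {- real n..real n})"
        using \<open>x \<in> X\<close> by (auto simp: abs_le_iff intro!: exI[of _ n])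
    qed
    moreover have "incseq (\<lambda>n. X \<inter> {- real n..real n})"
      by (auto simp: incseq_def)
    moreover have "range (\<lambda>n. X \<inter> {- real n..real n}) \<subseteq> sets lborel" by auto
    ultimately show ?thesis
      using Lim_emeasure_incseq[of "\<lambda>n. X \<inter> {- real n..real n}" lborel] by (simp only:)
  qed
  obtain a b where ab: "a \<in> A" "b \<in> B" using ne by auto
  obtain n where n: "max \<bar>a\<bar> \<bar>b\<bar> \<le> real n" using real_arch_simple by blast
  show ?thesis
  proof (rule LIMSEQ_le_const2[OF tendsto_add[OF lim lim]])
    show "\<exists>N. \<forall>m\<ge>N. emeasure lborel (A \<inter> {- real m..real m}) +
        emeasure lborel (B \<inter> {- real m..real m}) \<le> emeasure lborel C"
    proof (intro exI allI impI)
      fix m assume "m \<ge> n"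
      then have "real n \<le> real m" by simp
      then have "a \<in> A \<inter> {- real m..real m}" "b \<in> B \<inter> {- real m..real m}"
        using n ab by auto
      then show "emeasure lborel (A \<inter> {- real m..real m}) +
        emeasure lborel (B \<inter> {- real m..real m}) \<le> emeasure lborel C"
        by (intro brunn_minkowski_real_bounded)
           (auto intro: sum bounded_subset[OF bounded_closed_interval])
    qed
  qed auto
qed

lemma brunn_minkowski_real_weighted:
  fixes A B C :: "real set"
  assumes [measurable]: "A \<in> sets borel" "B \<in> sets borel" "C \<in> sets borel"
    and ne: "A \<noteq> {}" "B \<noteq> {}" and pos: "s > 0" "t > 0"
    and sum: "\<And>a b. a \<in> A \<Longrightarrow> b \<in> B \<Longrightarrow> t * a + s * b \<in> C"
  shows "ennreal t * emeasure lborel A + ennreal s * emeasure lborel B \<le> emeasure lborel C"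
proof -
  have "emeasure lborel {x. x / t \<in> A} + emeasure lborel {x. x / s \<in> B} \<le> emeasure lborel C"
  proof (rule brunn_minkowski_real)
    obtain a b where "a \<in> A" "b \<in> B" using ne by auto
    then have "t * a \<in> {x. x / t \<in> A}" "s * b \<in> {x. x / s \<in> B}" using pos by auto
    then show "{x. x / t \<in> A} \<noteq> {}" "{x. x / s \<in> B} \<noteq> {}" by blast+
    fix a b assume "a \<in> {x. x / t \<in> A}" "b \<in> {x. x / s \<in> B}"
    then show "a + b \<in> C" using sum[of "a/t" "b/s"] pos by auto
  qed measurable
  then show ?thesis using pos by (simp add: emeasure_lborel_dilate)
qed

section \<open>The Prekopa--Leindler inequality\<close>

lemma nn_integral_layer_cake:
  assumes "sigma_finite_measure M" and [measurable]: "f \<in> borel_measurable M"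
  shows "(\<integral>\<^sup>+x. f x \<partial>M) =
    (\<integral>\<^sup>+l. indicator {0<..} l * emeasure M {x\<in>space M. ennreal l < f x} \<partial>lborel)"
proof -
  interpret M: sigma_finite_measure M by fact
  interpret pair_sigma_finite M "lborel :: real measure" ..
  have length_below: "u = (\<integral>\<^sup>+l. indicator {l. 0 < l \<and> ennreal l < u} l \<partial>lborel)" for u
  proof (cases u)
    case (real r)
    then have "{l. 0 < l \<and> ennreal l < u} = {0<..<r}" by (auto simp: ennreal_less_iff)
    then show ?thesis using real by simp
  next
    case top
    have "emeasure lborel {0::real<..} = \<infinity>"
    proof (rule ccontr)
      assume "emeasure lborel {0::real<..} \<noteq> \<infinity>"
      then obtain r where r: "emeasure lborel {0::real<..} = ennreal r" "r \<ge> 0"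
        by (cases "emeasure lborel {0::real<..}") auto
      have "ennreal (r + 1) = emeasure lborel {0<..<r+1}" using r by simp
      also have "\<dots> \<le> emeasure lborel {0::real<..}" by (intro emeasure_mono) auto
      finally show False using r by (simp add: ennreal_le_iff)
    qed
    moreover have "{l. 0 < l \<and> ennreal l < u} = {0<..}" using top by auto
    ultimately show ?thesis using top by simp
  qed
  have "(\<integral>\<^sup>+x. f x \<partial>M) = (\<integral>\<^sup>+x. (\<integral>\<^sup>+l. indicator {l. 0 < l \<and> ennreal l < f x} l \<partial>lborel) \<partial>M)"
    using length_below by (intro nn_integral_cong) blast
  also have "\<dots> = (\<integral>\<^sup>+l. (\<integral>\<^sup>+x. indicator {l. 0 < l \<and> ennreal l < f x} l \<partial>M) \<partial>lborel)"
    by (rule Fubini'[symmetric]) measurable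
  also have "\<dots> = (\<integral>\<^sup>+l. indicator {0<..} l * emeasure M {x\<in>space M. ennreal l < f x} \<partial>lborel)"
  proof (rule nn_integral_cong)
    fix l :: real
    have "(\<integral>\<^sup>+x. indicator {l. 0 < l \<and> ennreal l < f x} l \<partial>M) =
        (\<integral>\<^sup>+x. indicator {0<..} l * indicator {x\<in>space M. ennreal l < f x} x \<partial>M)"
      by (intro nn_integral_cong) (auto simp: indicator_def)
    then show "(\<integral>\<^sup>+x. indicator {l. 0 < l \<and> ennreal l < f x} l \<partial>M) =
        indicator {0<..} l * emeasure M {x\<in>space M. ennreal l < f x}"
      by (simp add: nn_integral_cmult)
  qed
  finally show ?thesis .
qed

text \<open>
  When both suprema are \<open>1\<close>, the level sets of \<open>f\<close> and \<open>g\<close> at a height \<open>l\<close> are either both empty (if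
  \<open>l \<ge> 1\<close>) or both nonempty (if \<open>l < 1\<close>). This is exactly what Brunn--Minkowski needs: without
  nonemptiness \<open>t |A| + s |B| \<le> |C|\<close> would fail. Integrating over \<open>l\<close> gives even the arithmetic mean of the
  two integrals as a lower bound.
\<close>

lemma prekopa_leindler_real_normalized:
  fixes f g h :: "real \<Rightarrow> ennreal"
  assumes [measurable]: "f \<in> borel_measurable borel" "g \<in> borel_measurable borel"
      "h \<in> borel_measurable borel"
    and pos: "s > 0" "t > 0"
    and sup: "(SUP x. f x) = 1" "(SUP x. g x) = 1"
    and le: "\<And>x y l. 0 < l \<Longrightarrow> ennreal l < f x \<Longrightarrow> ennreal l < g y \<Longrightarrow> ennreal l \<le> h (t * x + s * y)"
  shows "ennreal t * (\<integral>\<^sup>+x. f x \<partial>lborel) + ennreal s * (\<integral>\<^sup>+x. g x \<partial>lborel) \<le> (\<integral>\<^sup>+x. h x \<partial>lborel)"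
proof -
  have lc: "(\<integral>\<^sup>+x. u x \<partial>lborel) = (\<integral>\<^sup>+l. indicator {0<..} l * emeasure lborel {x. ennreal l < u x} \<partial>lborel)"
    if "u \<in> borel_measurable borel" for u :: "real \<Rightarrow> ennreal"
    using nn_integral_layer_cake[OF sigma_finite_lborel, of u] that by simp
  have m[measurable]: "(\<lambda>l. emeasure lborel {x. ennreal l < u x}) \<in> borel_measurable borel"
    if [measurable]: "u \<in> borel_measurable borel" for u :: "real \<Rightarrow> ennreal"
    by (rule lborel.measurable_emeasure) (simp, measurable)
  have "ennreal t * (\<integral>\<^sup>+x. f x \<partial>lborel) + ennreal s * (\<integral>\<^sup>+x. g x \<partial>lborel) =
    (\<integral>\<^sup>+l. ennreal t * (indicator {0<..} l * emeasure lborel {x. ennreal l < f x})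
        + ennreal s * (indicator {0<..} l * emeasure lborel {x. ennreal l < g x}) \<partial>lborel)"
    unfolding lc[OF assms(1)] lc[OF assms(2)] by (simp add: nn_integral_add nn_integral_cmult)
  also have "\<dots> \<le> (\<integral>\<^sup>+l. indicator {0<..} l * emeasure lborel {x. ennreal l < h x} \<partial>lborel)"
  proof (rule nn_integral_mono)
    fix l :: real
    consider "l \<le> 0" | "l \<ge> 1" | "0 < l" "l < 1" by linarith
    then show "ennreal t * (indicator {0<..} l * emeasure lborel {x. ennreal l < f x})
        + ennreal s * (indicator {0<..} l * emeasure lborel {x. ennreal l < g x})
        \<le> indicator {0<..} l * emeasure lborel {x. ennreal l < h x}"
    proof cases
      case 2
      have "\<not> ennreal l < u x" if "(SUP x. u x) = 1" for u :: "real \<Rightarrow> ennreal" and x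
      proof -
        have "u x \<le> 1" using that by (metis SUP_upper UNIV_I)
        also have "1 \<le> ennreal l" using 2 by simp
        finally show ?thesis by (simp add: not_less)
      qed
      then show ?thesis using sup by simp
    next
      case 3
      have "ennreal l < 1" using 3 by (simp add: ennreal_less_one_iff)
      then have ne: "{x. ennreal l < f x} \<noteq> {}" "{x. ennreal l < g x} \<noteq> {}"
        using less_SUP_iff[of "ennreal l" f UNIV] less_SUP_iff[of "ennreal l" g UNIV] sup by auto
      have "ennreal t * emeasure lborel {x. ennreal l < f x} + ennreal s * emeasure lborel {x. ennreal l < g x}
        \<le> emeasure lborel {x. ennreal l < h x}"
      proof (rule brunn_minkowski_real_weighted[OF _ _ _ ne pos])
        fix a b assume "a \<in> {x. ennreal l < f x}" "b \<in> {x. ennreal l < g x}"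
        \<comment> \<open>The hypothesis only gives a weak inequality for \<open>h\<close>, so a slightly larger level is used.\<close>
        then have "ennreal l < min (f a) (g b)" by simp
        then obtain q where q: "ennreal l < q" "q < min (f a) (g b)" using dense by blast
        then obtain r where r: "q = ennreal r" "r \<ge> 0" by (cases q) auto
        have "r > 0" using q(1) r 3 by (auto simp: ennreal_less_iff)
        have "ennreal l < ennreal r" using q r by simp
        also have "ennreal r \<le> h (t * a + s * b)" using q r \<open>r > 0\<close> by (intro le) auto
        finally show "t * a + s * b \<in> {x. ennreal l < h x}" by simp
      qed auto
      then show ?thesis using 3 by simp
    qed simp
  qed
  also have "\<dots> = (\<integral>\<^sup>+x. h x \<partial>lborel)" by (rule lc[symmetric]) simp
  finally show ?thesis .
qed

text \<open>
  This is \<open>u\<^sup>t v\<^sup>1\<^sup>-\<^sup>t \<le> w\<close> for extended nonnegative \<open>u\<close>, \<open>v\<close>, \<open>w\<close>, with \<open>0 \<cdot> \<infinity> = 0\<close>. Approximating \<open>u\<close> and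
  \<open>v\<close> strictly from below avoids powers of \<open>\<infinity>\<close>, which arise because the marginals in the
  tensorization step may be infinite, and it makes truncation arguments immediate.
\<close>

definition geo_mean_le :: "real \<Rightarrow> ennreal \<Rightarrow> ennreal \<Rightarrow> ennreal \<Rightarrow> bool" where
  "geo_mean_le t u v w \<longleftrightarrow>
     (\<forall>a>0. \<forall>b>0. ennreal a < u \<longrightarrow> ennreal b < v \<longrightarrow> ennreal (a powr t * b powr (1 - t)) \<le> w)"

lemma nn_integral_truncate:
  assumes [measurable]: "f \<in> borel_measurable M" and "a < (\<integral>\<^sup>+x. f x \<partial>M)"
  shows "\<exists>n::nat. a < (\<integral>\<^sup>+x. min (f x) (of_nat n) \<partial>M)"
proof -
  have "(SUP n::nat. min u (of_nat n)) = u" for u :: ennreal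
  proof -
    have "(SUP n::nat. min u (of_nat n)) = min u (SUP n::nat. of_nat n)"
      by (subst inf_min[symmetric] inf_SUP)+ (simp add: inf_min)
    then show ?thesis by (simp add: ennreal_SUP_of_nat_eq_top)
  qed
  then have "(\<integral>\<^sup>+x. f x \<partial>M) = (\<integral>\<^sup>+x. (SUP n::nat. min (f x) (of_nat n)) \<partial>M)" by simp
  also have "\<dots> = (SUP n::nat. (\<integral>\<^sup>+x. min (f x) (of_nat n) \<partial>M))"
    by (intro nn_integral_monotone_convergence_SUP)
       (auto simp: incseq_def le_fun_def intro!: min.coboundedI2)
  finally show ?thesis using assms(2) by (simp add: less_SUP_iff)
qed

lemma weighted_am_gm:
  fixes a b t :: real
  assumes "0 < t" "t < 1" "a > 0" "b > 0"
  shows "a powr t * b powr (1 - t) \<le> t * a + (1 - t) * b"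
  using Youngs_inequality_0[of t "1 - t" a b] assms by auto

text \<open>
  By monotone convergence \<open>f\<close> and \<open>g\<close> may be replaced by bounded truncations without losing
  \<open>a < \<integral> f\<close> and \<open>b < \<integral> g\<close>. Dividing by the suprema \<open>mf\<close> and \<open>mg\<close> reduces to the normalized case; the
  weighted arithmetic mean obtained there dominates the geometric mean, and the normalizing factor
  \<open>K\<close> cancels.
\<close>

lemma prekopa_leindler_real:
  fixes f g h :: "real \<Rightarrow> ennreal"
  assumes [measurable]: "f \<in> borel_measurable borel" "g \<in> borel_measurable borel"
      "h \<in> borel_measurable borel"
    and t: "0 < t" "t < 1"
    and le: "\<And>x y. geo_mean_le t (f x) (g y) (h (t * x + (1 - t) * y))"
  shows "geo_mean_le t (\<integral>\<^sup>+x. f x \<partial>lborel) (\<integral>\<^sup>+x. g x \<partial>lborel) (\<integral>\<^sup>+x. h x \<partial>lborel)"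
  unfolding geo_mean_le_def
proof (intro allI impI)
  fix a b :: real
  assume ab: "a > 0" "b > 0" "ennreal a < (\<integral>\<^sup>+x. f x \<partial>lborel)" "ennreal b < (\<integral>\<^sup>+x. g x \<partial>lborel)"
  have trunc: "\<exists>u m. u \<in> borel_measurable borel \<and> m > 0 \<and> (SUP x. u x) = ennreal m \<and>
      (\<forall>x. u x \<le> v x) \<and> ennreal c < (\<integral>\<^sup>+x. u x \<partial>lborel)"
    if [measurable]: "v \<in> borel_measurable borel" and c: "c > 0" "ennreal c < (\<integral>\<^sup>+x. v x \<partial>lborel)"
    for v :: "real \<Rightarrow> ennreal" and c
  proof -
    obtain n :: nat where n: "ennreal c < (\<integral>\<^sup>+x. min (v x) (of_nat n) \<partial>lborel)"
      using nn_integral_truncate[OF _ c(2)] that by auto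
    define u where "u = (\<lambda>x. min (v x) (of_nat n :: ennreal))"
    have "(SUP x. u x) \<le> of_nat n" by (intro SUP_least) (simp add: u_def)
    then have "(SUP x. u x) < top" using le_less_trans of_nat_less_top by blast
    then obtain m where m: "(SUP x. u x) = ennreal m" "m \<ge> 0" by (cases "SUP x. u x") auto
    have "m \<noteq> 0"
    proof
      assume "m = 0"
      then have "u x = 0" for x using m SUP_upper[of x UNIV u] by simp
      then show False using n by (simp add: u_def)
    qed
    then show ?thesis using m n by (intro exI[of _ u] exI[of _ m]) (auto simp: u_def)
  qed
  obtain f' mf where f'[measurable]: "f' \<in> borel_measurable borel" and f: "mf > 0"
      "(SUP x. f' x) = ennreal mf" "\<And>x. f' x \<le> f x" "ennreal a < (\<integral>\<^sup>+x. f' x \<partial>lborel)"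
    using trunc[of f a] ab by auto
  obtain g' mg where g'[measurable]: "g' \<in> borel_measurable borel" and g: "mg > 0"
      "(SUP x. g' x) = ennreal mg" "\<And>x. g' x \<le> g x" "ennreal b < (\<integral>\<^sup>+x. g' x \<partial>lborel)"
    using trunc[of g b] ab by auto
  define K where "K = mf powr t * mg powr (1 - t)"
  have K: "K > 0" using f g by (simp add: K_def)
  have scale: "ennreal (l * m) < v" if "l > 0" "m > 0" "ennreal l < ennreal (1/m) * v" for l m v
  proof (cases v)
    case (real r)
    then have "l < 1/m * r" using that by (auto simp: ennreal_mult[symmetric] ennreal_less_iff)
    then show ?thesis using real that by (auto simp: field_simps ennreal_less_iff)
  qed auto
  have "ennreal t * (\<integral>\<^sup>+x. ennreal (1/mf) * f' x \<partial>lborel) +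
      ennreal (1 - t) * (\<integral>\<^sup>+x. ennreal (1/mg) * g' x \<partial>lborel)
      \<le> (\<integral>\<^sup>+x. ennreal (1/K) * h x \<partial>lborel)"
  proof (rule prekopa_leindler_real_normalized)
    show "(SUP x. ennreal (1/mf) * f' x) = 1" "(SUP x. ennreal (1/mg) * g' x) = 1"
      using f g by (simp_all add: SUP_mult_left_ennreal[symmetric] ennreal_mult[symmetric])
    fix x y l :: real
    assume l: "l > 0" "ennreal l < ennreal (1/mf) * f' x" "ennreal l < ennreal (1/mg) * g' y"
    then have "ennreal (l * mf) < f x" "ennreal (l * mg) < g y"
      using scale f g less_le_trans by blast+
    then have "ennreal ((l * mf) powr t * (l * mg) powr (1 - t)) \<le> h (t * x + (1 - t) * y)"
      using le[of x y] l f g by (auto simp: geo_mean_le_def)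
    also have "(l * mf) powr t * (l * mg) powr (1 - t) = l * K"
      using l f g powr_add[of l t "1 - t"] by (simp add: powr_mult K_def algebra_simps)
    finally have "ennreal (1/K) * ennreal (l * K) \<le> ennreal (1/K) * h (t * x + (1 - t) * y)"
      by (rule mult_left_mono) simp
    then show "ennreal l \<le> ennreal (1/K) * h (t * x + (1 - t) * y)"
      using K l by (simp add: ennreal_mult[symmetric])
  qed (use t in auto)
  then have *: "ennreal t * (ennreal (1/mf) * (\<integral>\<^sup>+x. f' x \<partial>lborel)) +
      ennreal (1 - t) * (ennreal (1/mg) * (\<integral>\<^sup>+x. g' x \<partial>lborel))
      \<le> ennreal (1/K) * (\<integral>\<^sup>+x. h x \<partial>lborel)"
    by (simp add: nn_integral_cmult)
  have "a powr t * b powr (1 - t) / K = (a / mf) powr t * (b / mg) powr (1 - t)"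
    using ab f g by (simp add: K_def powr_divide)
  also have "\<dots> \<le> t * (a / mf) + (1 - t) * (b / mg)"
    using weighted_am_gm[of t "a/mf" "b/mg"] t ab f g by simp
  finally have "ennreal (a powr t * b powr (1 - t) / K) \<le> ennreal (t * (a / mf) + (1 - t) * (b / mg))"
    by (rule ennreal_leI)
  also have "\<dots> = ennreal t * (ennreal (1/mf) * ennreal a) + ennreal (1 - t) * (ennreal (1/mg) * ennreal b)"
    using t ab f g by (simp add: ennreal_mult[symmetric] ennreal_plus[symmetric] del: ennreal_plus)
  also have "\<dots> \<le> ennreal (1/K) * (\<integral>\<^sup>+x. h x \<partial>lborel)"
    using f(4) g(4) by (intro order.trans[OF _ *] add_mono mult_left_mono) auto
  finally have "ennreal K * ennreal (a powr t * b powr (1 - t) / K)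
      \<le> ennreal K * (ennreal (1/K) * (\<integral>\<^sup>+x. h x \<partial>lborel))"
    by (rule mult_left_mono) simp
  then show "ennreal (a powr t * b powr (1 - t)) \<le> (\<integral>\<^sup>+x. h x \<partial>lborel)"
    using K ab by (simp add: ennreal_mult[symmetric] mult.assoc[symmetric])
qed

text \<open>
  The relation is stable under integration in one variable: the one-dimensional inequality
  shows that the partial integrals of \<open>f\<close>, \<open>g\<close>, \<open>h\<close> over coordinate \<open>i\<close> again satisfy the hypothesis.
  The points are extensional functions, so the combination \<open>z\<close> is described by its coordinates in \<open>I\<close>.
\<close>

lemma prekopa_leindler_PiM:
  fixes f g h :: "('i \<Rightarrow> real) \<Rightarrow> ennreal"
  assumes t: "0 < t" "t < 1" and "finite I"
    and "f \<in> borel_measurable (PiM I (\<lambda>_. lborel))" "g \<in> borel_measurable (PiM I (\<lambda>_. lborel))"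
      "h \<in> borel_measurable (PiM I (\<lambda>_. lborel))"
    and "\<And>x y z. x \<in> extensional I \<Longrightarrow> y \<in> extensional I \<Longrightarrow> z \<in> extensional I \<Longrightarrow>
       (\<And>i. i \<in> I \<Longrightarrow> z i = t * x i + (1 - t) * y i) \<Longrightarrow> geo_mean_le t (f x) (g y) (h z)"
  shows "geo_mean_le t (\<integral>\<^sup>+x. f x \<partial>PiM I (\<lambda>_. lborel)) (\<integral>\<^sup>+x. g x \<partial>PiM I (\<lambda>_. lborel))
     (\<integral>\<^sup>+x. h x \<partial>PiM I (\<lambda>_. lborel))"
  using assms(3-7)
proof (induction I arbitrary: f g h)
  case empty
  interpret product_sigma_finite "\<lambda>_::'i. lborel :: real measure" ..
  have *: "(\<integral>\<^sup>+x. u x \<partial>PiM {} (\<lambda>_. lborel)) = u (\<lambda>_. undefined)" for u :: "('i \<Rightarrow> real) \<Rightarrow> ennreal"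
    by (simp add: PiM_empty nn_integral_count_space_finite)
  show ?case unfolding * by (intro empty) auto
next
  case (insert i I)
  interpret product_sigma_finite "\<lambda>_::'i. lborel :: real measure" ..
  note [measurable] = insert.prems(1-3)
  have m: "(\<lambda>u. k (x(i := u))) \<in> borel_measurable borel"
    if [measurable]: "k \<in> borel_measurable (PiM (insert i I) (\<lambda>_. lborel))" and x: "x \<in> extensional I"
    for k :: "('i \<Rightarrow> real) \<Rightarrow> ennreal" and x
  proof -
    have [measurable]: "x \<in> space (PiM I (\<lambda>_. lborel))" using x by (simp add: space_PiM PiE_def)
    have "(\<lambda>u. k (x(i := u))) \<in> borel_measurable lborel" by measurable
    then show ?thesis by simp
  qed
  have "geo_mean_le t (\<integral>\<^sup>+x. (\<integral>\<^sup>+u. f (x(i := u)) \<partial>lborel) \<partial>PiM I (\<lambda>_. lborel))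
      (\<integral>\<^sup>+x. (\<integral>\<^sup>+u. g (x(i := u)) \<partial>lborel) \<partial>PiM I (\<lambda>_. lborel))
      (\<integral>\<^sup>+x. (\<integral>\<^sup>+u. h (x(i := u)) \<partial>lborel) \<partial>PiM I (\<lambda>_. lborel))"
  proof (rule insert.IH)
    fix x y z :: "'i \<Rightarrow> real"
    assume ext: "x \<in> extensional I" "y \<in> extensional I" "z \<in> extensional I"
      and z: "\<And>j. j \<in> I \<Longrightarrow> z j = t * x j + (1 - t) * y j"
    show "geo_mean_le t (\<integral>\<^sup>+u. f (x(i := u)) \<partial>lborel) (\<integral>\<^sup>+u. g (y(i := u)) \<partial>lborel)
        (\<integral>\<^sup>+u. h (z(i := u)) \<partial>lborel)"
    proof (rule prekopa_leindler_real[OF m m m t])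
      fix u v :: real
      show "geo_mean_le t (f (x(i := u))) (g (y(i := v))) (h (z(i := t * u + (1 - t) * v)))"
        using ext z insert.hyps by (intro insert.prems(4)) (auto simp: extensional_def)
    qed (use ext in auto)
  qed measurable
  then show ?case
    using insert.hyps by (simp add: product_nn_integral_insert)
qed

theorem prekopa_leindler:
  fixes f g h :: "'a::euclidean_space \<Rightarrow> ennreal"
  assumes t: "0 < t" "t < 1"
    and [measurable]: "f \<in> borel_measurable borel" "g \<in> borel_measurable borel"
      "h \<in> borel_measurable borel"
    and le: "\<And>x y. geo_mean_le t (f x) (g y) (h (t *\<^sub>R x + (1 - t) *\<^sub>R y))"
  shows "geo_mean_le t (\<integral>\<^sup>+x. f x \<partial>lborel) (\<integral>\<^sup>+x. g x \<partial>lborel) (\<integral>\<^sup>+x. h x \<partial>lborel)"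
proof -
  have eq: "(\<integral>\<^sup>+x. u x \<partial>lborel) =
      (\<integral>\<^sup>+x. u (\<Sum>b\<in>Basis. x b *\<^sub>R b) \<partial>PiM Basis (\<lambda>_. lborel))"
    if [measurable]: "u \<in> borel_measurable borel" for u :: "'a \<Rightarrow> ennreal"
    by (subst lborel_eq) (simp add: nn_integral_distr)
  show ?thesis
    unfolding eq[OF assms(3)] eq[OF assms(4)] eq[OF assms(5)]
  proof (rule prekopa_leindler_PiM[OF t])
    fix x y z :: "'a \<Rightarrow> real"
    assume "\<And>b. b \<in> Basis \<Longrightarrow> z b = t * x b + (1 - t) * y b"
    then have "(\<Sum>b\<in>Basis. z b *\<^sub>R b) =
        t *\<^sub>R (\<Sum>b\<in>Basis. x b *\<^sub>R b) + (1 - t) *\<^sub>R (\<Sum>b\<in>Basis. y b *\<^sub>R b)"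
      by (simp add: scaleR_add_left scaleR_sum_right sum.distrib)
    then show "geo_mean_le t (f (\<Sum>b\<in>Basis. x b *\<^sub>R b)) (g (\<Sum>b\<in>Basis. y b *\<^sub>R b))
        (h (\<Sum>b\<in>Basis. z b *\<^sub>R b))"
      using le by simp
  qed (simp, measurable)
qed

section \<open>Concentration for strongly log-concave densities\<close>

lemma geo_mean_le_ennreal:
  assumes "0 < t" "t < 1" "0 \<le> u" "0 \<le> v" "u powr t * v powr (1 - t) \<le> w"
  shows "geo_mean_le t (ennreal u) (ennreal v) (ennreal w)"
  unfolding geo_mean_le_def
proof (intro allI impI)
  fix a b assume ab: "a > 0" "b > 0" "ennreal a < ennreal u" "ennreal b < ennreal v"
  then have "a \<le> u" "b \<le> v" by (auto simp: ennreal_less_iff)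
  then have "a powr t * b powr (1 - t) \<le> u powr t * v powr (1 - t)"
    using ab assms by (intro mult_mono powr_mono2) auto
  then show "ennreal (a powr t * b powr (1 - t)) \<le> ennreal w"
    using assms by (intro ennreal_leI) simp
qed

text \<open>
  For \<open>q = exp (- U)\<close>, where \<open>U\<close> may take the value \<open>\<infinity>\<close>, this says that \<open>U\<close> is \<open>\<rho>\<close>-convex. The
  multiplicative form takes the value \<open>\<infinity>\<close> into account through \<open>0 powr t = 0\<close>.
\<close>

definition strongly_log_concave :: "real \<Rightarrow> ('a::real_inner \<Rightarrow> real) \<Rightarrow> bool" where
  "strongly_log_concave \<rho> q \<longleftrightarrow> (\<forall>x. 0 \<le> q x) \<and>
     (\<forall>x y. \<forall>t\<in>{0<..<1}.
        q x powr t * q y powr (1 - t) * exp (\<rho> * t * (1 - t) / 2 * (norm (x - y))\<^sup>2)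
          \<le> q (t *\<^sub>R x + (1 - t) *\<^sub>R y))"

text \<open>
  The constant \<open>L\<^sup>2 / (2 (1 - t) \<rho>)\<close> is the largest value of \<open>L d - (1 - t) \<rho> d\<^sup>2 / 2\<close>, where \<open>d\<close> stands for
  \<open>|x - y|\<close>: the increment of \<open>G\<close> is compensated by the gain from strong log-concavity. The exponent
  \<open>t / (1 - t)\<close> of the second tilt makes \<open>G y\<close> enter with weight \<open>t\<close>, as \<open>G x\<close> does.
\<close>

lemma prekopa_leindler_tilted:
  fixes q G :: "'a::euclidean_space \<Rightarrow> real"
  assumes q: "strongly_log_concave \<rho> q" "\<rho> > 0" and [measurable]: "q \<in> borel_measurable borel"
    and G: "L-lipschitz_on UNIV G" and t: "0 < t" "t < 1"
  shows "geo_mean_le t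
    (\<integral>\<^sup>+x. ennreal (exp (G x - L\<^sup>2 / (2 * (1 - t) * \<rho>)) * q x) \<partial>lborel)
    (\<integral>\<^sup>+x. ennreal (exp (- (t / (1 - t)) * G x) * q x) \<partial>lborel)
    (\<integral>\<^sup>+x. ennreal (q x) \<partial>lborel)"
proof (rule prekopa_leindler[OF t])
  have "continuous_on UNIV G" using G by (rule lipschitz_on_continuous_on)
  then have [measurable]: "G \<in> borel_measurable borel" by (rule borel_measurable_continuous_onI)
  show "(\<lambda>x. ennreal (exp (G x - L\<^sup>2 / (2 * (1 - t) * \<rho>)) * q x)) \<in> borel_measurable borel"
    "(\<lambda>x. ennreal (exp (- (t / (1 - t)) * G x) * q x)) \<in> borel_measurable borel"
    "(\<lambda>x. ennreal (q x)) \<in> borel_measurable borel" by measurable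
  define s where "s = 1 - t"
  have s: "s > 0" using t by (simp add: s_def)
  fix x y :: 'a
  define d where "d = norm (x - y)"
  define c where "c = L\<^sup>2 / (2 * s * \<rho>)"
  have "G x - G y \<le> L * d"
    using lipschitz_onD[OF G, of x y] by (simp add: dist_norm d_def abs_le_iff)
  also have "L * d \<le> c + s * \<rho> / 2 * d\<^sup>2"
  proof -
    have "0 \<le> (L - s * \<rho> * d)\<^sup>2 / (2 * s * \<rho>)" using s q by simp
    also have "\<dots> = c + s * \<rho> / 2 * d\<^sup>2 - L * d"
      using s q by (simp add: c_def power2_eq_square field_simps)
    finally show ?thesis by simp
  qed
  finally have "t * (G x - c) - t * G y \<le> \<rho> * t * s / 2 * d\<^sup>2"
    using mult_left_mono[of "G x - G y" "c + s * \<rho> / 2 * d\<^sup>2" t] t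
    by (simp add: algebra_simps)
  then have le: "exp (t * (G x - c) - t * G y) \<le> exp (\<rho> * t * s / 2 * d\<^sup>2)"
    by simp
  have "(exp (G x - c) * q x) powr t * (exp (- (t / s) * G y) * q y) powr s
      = q x powr t * q y powr s * exp (t * (G x - c) - t * G y)"
  proof -
    have "exp (- (t / s) * G y) powr s = exp (- t * G y)"
      using s by (simp add: powr_def)
    moreover have "exp (G x - c) powr t = exp (t * (G x - c))"
      by (simp add: powr_def)
    moreover have "exp (t * (G x - c) - t * G y) = exp (t * (G x - c)) * exp (- t * G y)"
      by (simp add: exp_add[symmetric])
    ultimately show ?thesis
      by (simp only: powr_mult ac_simps)
  qed
  also have "\<dots> \<le> q x powr t * q y powr s * exp (\<rho> * t * s / 2 * d\<^sup>2)"
    by (intro mult_left_mono le) auto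
  also have "\<dots> \<le> q (t *\<^sub>R x + s *\<^sub>R y)"
    using q t by (auto simp: strongly_log_concave_def s_def d_def)
  finally show "geo_mean_le t (ennreal (exp (G x - L\<^sup>2 / (2 * (1 - t) * \<rho>)) * q x))
      (ennreal (exp (- (t / (1 - t)) * G y) * q y)) (ennreal (q (t *\<^sub>R x + (1 - t) *\<^sub>R y)))"
    using q t by (intro geo_mean_le_ennreal) (auto simp: strongly_log_concave_def s_def c_def)
qed

locale strongly_log_concave_prob =
  fixes q :: "'a::euclidean_space \<Rightarrow> real" and \<rho> :: real
  assumes rho_pos: "\<rho> > 0"
    and slc: "strongly_log_concave \<rho> q"
    and q_measurable [measurable]: "q \<in> borel_measurable borel"
    and q_total: "(\<integral>\<^sup>+x. ennreal (q x) \<partial>lborel) = 1"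
begin

definition \<mu> :: "'a measure" where "\<mu> = density lborel (\<lambda>x. ennreal (q x))"

lemma sets_mu [measurable_cong, simp]: "sets \<mu> = sets borel"
  and space_mu [simp]: "space \<mu> = UNIV"
  by (simp_all add: \<mu>_def)

sublocale prob_space \<mu>
  by standard (simp add: \<mu>_def emeasure_density q_total)

lemma prob_UNIV: "prob UNIV = 1"
  using prob_space by simp

lemma nn_integral_mu:
  assumes "\<And>x. 0 \<le> f x" and [measurable]: "f \<in> borel_measurable borel"
  shows "(\<integral>\<^sup>+x. ennreal (f x) \<partial>\<mu>) = (\<integral>\<^sup>+x. ennreal (f x * q x) \<partial>lborel)"
  using assms(1) slc
  by (simp add: \<mu>_def nn_integral_density strongly_log_concave_def ennreal_mult[symmetric] mult.commute)

lemma lipschitz_measurable: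
  fixes F :: "'a \<Rightarrow> real"
  assumes "C-lipschitz_on UNIV F"
  shows "F \<in> borel_measurable borel"
  using assms by (intro borel_measurable_continuous_onI lipschitz_on_continuous_on)

lemma geo_mean_exp_lipschitz:
  fixes G :: "'a \<Rightarrow> real"
  assumes G: "L-lipschitz_on UNIV G" and t: "0 < t" "t < 1"
  shows "geo_mean_le t (\<integral>\<^sup>+x. ennreal (exp (G x - L\<^sup>2 / (2 * (1 - t) * \<rho>))) \<partial>\<mu>)
    (\<integral>\<^sup>+x. ennreal (exp (- (t / (1 - t)) * G x)) \<partial>\<mu>) 1"
  using prekopa_leindler_tilted[OF slc rho_pos q_measurable G t] lipschitz_measurable[OF G]
  by (simp add: nn_integral_mu q_total)

text \<open>
  With equal weights the product of the integrals of \<open>exp G\<close>, up to a constant factor, and \<open>exp (- G)\<close> is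
  at most \<open>1\<close>. The second integral is strictly positive, so the first one is finite.
\<close>

lemma exp_lipschitz_integrable:
  fixes G :: "'a \<Rightarrow> real"
  assumes G: "L-lipschitz_on UNIV G"
  shows "integrable \<mu> (\<lambda>x. exp (G x))"
proof -
  note [measurable] = lipschitz_measurable[OF G]
  define c where "c = L\<^sup>2 / \<rho>"
  have gm: "geo_mean_le (1/2) (\<integral>\<^sup>+x. ennreal (exp (G x - c)) \<partial>\<mu>) (\<integral>\<^sup>+x. ennreal (exp (- G x)) \<partial>\<mu>) 1"
    using geo_mean_exp_lipschitz[OF G, of "1/2"] by (simp add: c_def)
  have "(\<integral>\<^sup>+x. ennreal (exp (- G x)) \<partial>\<mu>) \<noteq> 0"
  proof
    assume "(\<integral>\<^sup>+x. ennreal (exp (- G x)) \<partial>\<mu>) = 0"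
    then have "AE x in \<mu>. ennreal (exp (- G x)) = 0" by (subst (asm) nn_integral_0_iff_AE) auto
    then have "AE x in \<mu>. False" by simp
    then show False by simp
  qed
  then obtain e where e: "0 < e" "e < (\<integral>\<^sup>+x. ennreal (exp (- G x)) \<partial>\<mu>)"
    using dense[of 0 "\<integral>\<^sup>+x. ennreal (exp (- G x)) \<partial>\<mu>"] by (auto simp: zero_less_iff_neq_zero)
  then obtain b where "e = ennreal b" "b \<ge> 0" by (cases e) auto
  with e have b: "b > 0" "ennreal b < (\<integral>\<^sup>+x. ennreal (exp (- G x)) \<partial>\<mu>)" by auto
  have "(\<integral>\<^sup>+x. ennreal (exp (G x - c)) \<partial>\<mu>) \<noteq> \<infinity>"
  proof
    assume "(\<integral>\<^sup>+x. ennreal (exp (G x - c)) \<partial>\<mu>) = \<infinity>"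
    \<comment> \<open>Any real number lies below an infinite integral; \<open>4 / b\<close> makes the geometric mean equal to \<open>2\<close>.\<close>
    then have "ennreal ((4 / b) powr (1/2) * b powr (1/2)) \<le> 1"
      using gm b by (auto simp: geo_mean_le_def)
    moreover have "(4 / b) powr (1/2) * b powr (1/2) = 2"
      using b by (simp add: powr_half_sqrt real_sqrt_divide)
    ultimately show False by (simp add: ennreal_le_1)
  qed
  then have "integrable \<mu> (\<lambda>x. exp (G x - c))"
    by (intro integrableI_nonneg) (auto simp: top.not_eq_extremum)
  then have "integrable \<mu> (\<lambda>x. exp c * exp (G x - c))" by simp
  then show ?thesis by (simp add: exp_diff)
qed

lemma lipschitz_integrable:
  fixes F :: "'a \<Rightarrow> real"
  assumes F: "C-lipschitz_on UNIV F"
  shows "integrable \<mu> F"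
proof (rule Bochner_Integration.integrable_bound)
  show "integrable \<mu> (\<lambda>x. exp (F x) + exp (- F x))"
    using exp_lipschitz_integrable[OF F] exp_lipschitz_integrable[of C "\<lambda>x. - F x"] F by auto
  show "F \<in> borel_measurable \<mu>" using lipschitz_measurable[OF F] by simp
  have "\<bar>u\<bar> \<le> exp u + exp (- u)" for u :: real
    using exp_ge_add_one_self[of u] exp_ge_add_one_self[of "-u"] exp_gt_zero[of u] exp_gt_zero[of "-u"]
    by linarith
  then show "AE x in \<mu>. norm (F x) \<le> norm (exp (F x) + exp (- F x))"
    by (intro AE_I2) (simp add: abs_of_nonneg add_nonneg_nonneg)
qed

text \<open>
  Since \<open>exp v \<ge> 1 + v\<close> and \<open>G\<close> has mean zero, the tilt by \<open>- \<epsilon> G\<close> has total mass at least \<open>1\<close> for every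
  \<open>\<epsilon>\<close>. Prekopa--Leindler then bounds the other tilt by \<open>1\<close>, for each weight \<open>s < 1\<close> separately.
\<close>

lemma exp_centred_lipschitz_weighted:
  fixes G :: "'a \<Rightarrow> real"
  assumes G: "L-lipschitz_on UNIV G" and mean: "expectation G = 0" and s: "0 < s" "s < 1"
  shows "expectation (\<lambda>x. exp (G x)) \<le> exp (L\<^sup>2 / (2 * s * \<rho>))"
proof -
  note [measurable] = lipschitz_measurable[OF G]
  define t where "t = 1 - s"
  define \<epsilon> where "\<epsilon> = t / s"
  define c where "c = L\<^sup>2 / (2 * s * \<rho>)"
  have t: "0 < t" "t < 1" and \<epsilon>: "\<epsilon> > 0" using s by (auto simp: t_def \<epsilon>_def)
  have G': "(\<epsilon> * L)-lipschitz_on UNIV (\<lambda>x. - \<epsilon> * G x)"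
    using lipschitz_on_cmult_real[OF G, of "-\<epsilon>"] \<epsilon> by simp
  have int: "integrable \<mu> (\<lambda>x. exp (- \<epsilon> * G x))" "integrable \<mu> (\<lambda>x. exp (G x))"
    using exp_lipschitz_integrable[OF G'] exp_lipschitz_integrable[OF G] by auto
  have "1 = expectation (\<lambda>x. 1 + - \<epsilon> * G x)"
    using lipschitz_integrable[OF G] mean by (simp add: prob_UNIV)
  also have "\<dots> \<le> expectation (\<lambda>x. exp (- \<epsilon> * G x))"
    using int lipschitz_integrable[OF G] exp_ge_add_one_self[of "- \<epsilon> * G x" for x]
    by (intro integral_mono Bochner_Integration.integrable_add) auto
  finally have Y: "1 \<le> (\<integral>\<^sup>+x. ennreal (exp (- \<epsilon> * G x)) \<partial>\<mu>)"
    using int by (subst nn_integral_eq_integral) auto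
  have X: "(\<integral>\<^sup>+x. ennreal (exp (G x - c)) \<partial>\<mu>) = ennreal (exp (- c) * expectation (\<lambda>x. exp (G x)))"
  proof -
    have "(\<integral>\<^sup>+x. ennreal (exp (G x - c)) \<partial>\<mu>) = (\<integral>\<^sup>+x. ennreal (exp (- c) * exp (G x)) \<partial>\<mu>)"
      by (simp add: exp_diff exp_minus field_simps)
    also have "\<dots> = ennreal (expectation (\<lambda>x. exp (- c) * exp (G x)))"
      using int by (intro nn_integral_eq_integral) auto
    finally show ?thesis by simp
  qed
  have gm: "geo_mean_le t (\<integral>\<^sup>+x. ennreal (exp (G x - c)) \<partial>\<mu>) (\<integral>\<^sup>+x. ennreal (exp (- \<epsilon> * G x)) \<partial>\<mu>) 1"
    using geo_mean_exp_lipschitz[OF G t] by (simp add: c_def \<epsilon>_def t_def)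
  have "exp (- c) * expectation (\<lambda>x. exp (G x)) \<le> 1"
  proof (rule ccontr)
    assume "\<not> ?thesis"
    then have "1 < exp (- c) * expectation (\<lambda>x. exp (G x))" by simp
    from dense[OF this] obtain a where a: "1 < a" "a < exp (- c) * expectation (\<lambda>x. exp (G x))"
      by auto
    \<comment> \<open>This \<open>b < 1\<close> is so close to \<open>1\<close> that \<open>a powr t * b powr s = a powr (t / 2)\<close> still exceeds \<open>1\<close>.\<close>
    define b where "b = a powr (- t / (2 * s))"
    have b: "0 < b" "b < 1" using a s t by (auto simp: b_def intro!: powr_less_one)
    have "ennreal b < 1" using b by (simp add: ennreal_less_one_iff)
    then have "ennreal b < (\<integral>\<^sup>+x. ennreal (exp (- \<epsilon> * G x)) \<partial>\<mu>)" using Y by (rule less_le_trans)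
    moreover have "ennreal a < (\<integral>\<^sup>+x. ennreal (exp (G x - c)) \<partial>\<mu>)"
      using a unfolding X by (simp add: ennreal_less_iff)
    ultimately have "ennreal (a powr t * b powr (1 - t)) \<le> 1"
      using gm a b unfolding geo_mean_le_def by auto
    then have "a powr t * b powr s \<le> 1" by (simp add: ennreal_le_1 t_def)
    moreover have "a powr t * b powr s = a powr (t / 2)"
      using s a by (simp add: b_def powr_powr powr_add[symmetric])
    moreover have "1 < a powr (t / 2)" using a t by (simp add: gr_one_powr)
    ultimately show False by simp
  qed
  then show ?thesis unfolding c_def[symmetric] by (simp add: exp_minus field_simps)
qed

lemma exp_centred_lipschitz:
  fixes G :: "'a \<Rightarrow> real"
  assumes G: "L-lipschitz_on UNIV G" and mean: "expectation G = 0"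
  shows "expectation (\<lambda>x. exp (G x)) \<le> exp (L\<^sup>2 / (2 * \<rho>))"
proof -
  have lim: "((\<lambda>s. exp (L\<^sup>2 / (2 * s * \<rho>))) \<longlongrightarrow> exp (L\<^sup>2 / (2 * 1 * \<rho>))) (at_left 1)"
    using rho_pos by (intro tendsto_intros) auto
  have ev: "\<forall>\<^sub>F s in at_left 1. expectation (\<lambda>x. exp (G x)) \<le> exp (L\<^sup>2 / (2 * s * \<rho>))"
    using eventually_at_left_real[OF zero_less_one]
    by (rule eventually_mono) (rule exp_centred_lipschitz_weighted[OF G mean]; simp)
  show ?thesis
    using tendsto_lowerbound[OF lim ev] by simp
qed

text \<open>
  Chernoff's bound; \<open>l = \<rho> r / C\<^sup>2\<close> minimizes the exponent \<open>- l r + (l C)\<^sup>2 / (2 \<rho>)\<close>.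
\<close>

lemma upper_tail:
  fixes F :: "'a \<Rightarrow> real"
  assumes F: "C-lipschitz_on UNIV F" and C: "C > 0" and r: "r > 0"
  shows "prob {x. F x - expectation F \<ge> r} \<le> exp (- (\<rho> / C\<^sup>2 * (r\<^sup>2 / 2)))"
proof -
  note [measurable] = lipschitz_measurable[OF F]
  define l where "l = \<rho> * r / C\<^sup>2"
  have l: "l > 0" using rho_pos r C by (simp add: l_def)
  define G where "G = (\<lambda>x. l * (F x - expectation F))"
  have G: "(l * C)-lipschitz_on UNIV G"
    using lipschitz_on_cmult_real[OF lipschitz_on_diff[OF F lipschitz_on_constant[of UNIV "expectation F"]], of l] l
    by (simp add: G_def)
  have mean: "expectation G = 0"
    using lipschitz_integrable[OF F] by (simp add: G_def prob_UNIV)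
  have int: "integrable \<mu> (\<lambda>x. exp (G x))" by (rule exp_lipschitz_integrable[OF G])
  have "prob {x. F x - expectation F \<ge> r} = expectation (indicator {x. F x - expectation F \<ge> r})"
    by simp
  also have "\<dots> \<le> expectation (\<lambda>x. exp (- l * r) * exp (G x))"
  proof (rule integral_mono)
    show "integrable \<mu> (indicator {x. F x - expectation F \<ge> r} :: 'a \<Rightarrow> real)"
      by (intro integrable_real_indicator) (auto simp: less_top[symmetric])
    show "integrable \<mu> (\<lambda>x. exp (- l * r) * exp (G x))" using int by simp
    fix x
    have "1 \<le> exp (- l * r) * exp (G x)" if "F x - expectation F \<ge> r"
    proof -
      have "0 \<le> - l * r + G x" using that l by (simp add: G_def)
      then show ?thesis by (simp only: exp_add[symmetric] one_le_exp_iff)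
    qed
    then show "indicator {x. F x - expectation F \<ge> r} x \<le> exp (- l * r) * exp (G x)"
      by (auto simp: indicator_def)
  qed
  also have "\<dots> \<le> exp (- l * r) * exp ((l * C)\<^sup>2 / (2 * \<rho>))"
    using exp_centred_lipschitz[OF G mean] by simp
  also have "\<dots> = exp (- (\<rho> / C\<^sup>2 * (r\<^sup>2 / 2)))"
  proof -
    have "- l * r + (l * C)\<^sup>2 / (2 * \<rho>) = - (\<rho> / C\<^sup>2 * (r\<^sup>2 / 2))"
      using C rho_pos by (simp add: l_def power2_eq_square field_simps)
    then show ?thesis by (simp only: exp_add[symmetric])
  qed
  finally show ?thesis .
qed

theorem concentration:
  fixes F :: "'a \<Rightarrow> real"
  assumes F: "C-lipschitz_on UNIV F" and C: "C > 0" and r: "r > 0"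
  shows "prob {x. \<bar>F x - expectation F\<bar> \<ge> r} \<le> 2 * exp (- (\<rho> / C\<^sup>2 * (r\<^sup>2 / 2)))"
proof -
  note [measurable] = lipschitz_measurable[OF F]
  have F': "C-lipschitz_on UNIV (\<lambda>x. - F x)" using F by simp
  let ?U = "{x. F x - expectation F \<ge> r}" and ?L = "{x. - F x - expectation (\<lambda>x. - F x) \<ge> r}"
  have "{x. \<bar>F x - expectation F\<bar> \<ge> r} = ?U \<union> ?L"
    using r by (auto simp: abs_if)
  moreover have "prob (?U \<union> ?L) \<le> prob ?U + prob ?L"
    by (intro measure_Un_le) measurable
  ultimately show ?thesis
    using upper_tail[OF F C r] upper_tail[OF F' C r] by simp
qed

end

section \<open>Best Lipschitz constants\<close>

text \<open>
  Every admissible constant bounds each difference quotient of \<open>f\<close>; hence so does their infimum.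
\<close>

lemma lip_norm_attained:
  fixes f :: "'a::metric_space \<Rightarrow> 'b::metric_space"
  assumes "lip_norm f \<noteq> \<infinity>"
  obtains L where "L \<ge> 0" "lip_norm f = ennreal L" "L-lipschitz_on UNIV f"
proof -
  obtain L where L: "lip_norm f = ennreal L" "L \<ge> 0"
    using assms by (cases "lip_norm f") auto
  have "dist (f x) (f y) \<le> L * dist x y" for x y
  proof (cases "x = y")
    case False
    then have d: "dist x y > 0" by simp
    have "ennreal (dist (f x) (f y) / dist x y) \<le> lip_norm f"
      unfolding lip_norm_def
    proof (rule Inf_greatest)
      fix u assume "u \<in> {ennreal C |C. C-lipschitz_on UNIV f}"
      then obtain C where C: "u = ennreal C" "C-lipschitz_on UNIV f" by auto
      then show "ennreal (dist (f x) (f y) / dist x y) \<le> u"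
        using lipschitz_onD[OF C(2), of x y] d by (auto intro!: ennreal_leI simp: field_simps)
    qed
    then show ?thesis using L d by (simp add: field_simps)
  qed simp
  then show ?thesis using L by (intro that[of L] lipschitz_onI) auto
qed

text \<open>
  This turns the Lipschitz constant \<open>L / \<surd>n\<close> of an empirical mean into the factor \<open>n\<close> in the exponent.
\<close>

lemma gauss_exp_rescale:
  assumes "c > 0" "L \<ge> 0"
  shows "gauss_exp \<rho> (ennreal (L / sqrt c)) r = gauss_exp (c * \<rho>) (ennreal L) r"
  using assms by (simp add: gauss_exp_def power_divide mult.commute)

lemma lipschitz_on_component:
  "1-lipschitz_on UNIV (\<lambda>x :: real ^ 'n. x $ k)"
  by (intro lipschitz_onI) (auto simp: dist_vec_nth_le)

text \<open>
  The \<open>\<ell>\<^sup>1\<close> distance is at most \<open>\<surd>n\<close> times the Euclidean one, by Cauchy--Schwarz against the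
  constant vector \<open>1\<close>.
\<close>

lemma lipschitz_on_empirical_mean:
  fixes f :: "real \<Rightarrow> real"
  assumes f: "L-lipschitz_on UNIV f"
  shows "(L / sqrt (real CARD('n)))-lipschitz_on UNIV (empirical_mean f :: real ^ 'n::finite \<Rightarrow> real)"
proof (rule lipschitz_onI)
  define n where "n = real CARD('n)"
  have n: "n > 0" by (simp add: n_def)
  have L: "L \<ge> 0" using f by (rule lipschitz_on_nonneg)
  then show "0 \<le> L / sqrt (real CARD('n))" by simp
  fix x y :: "real ^ 'n"
  have "\<bar>(\<Sum>i\<in>UNIV. f (x $ i)) - (\<Sum>i\<in>UNIV. f (y $ i))\<bar> \<le> (\<Sum>i\<in>UNIV. \<bar>f (x $ i) - f (y $ i)\<bar>)"
    by (simp add: sum_subtractf[symmetric])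
  also have "\<dots> \<le> (\<Sum>i\<in>UNIV. L * \<bar>x $ i - y $ i\<bar>)"
    using lipschitz_onD[OF f] by (intro sum_mono) (auto simp: dist_real_def)
  also have "\<dots> = L * (\<Sum>i\<in>UNIV. \<bar>1\<bar> * \<bar>x $ i - y $ i\<bar>)" by (simp add: sum_distrib_left)
  also have "(\<Sum>i\<in>UNIV. \<bar>1\<bar> * \<bar>x $ i - y $ i\<bar>) \<le> L2_set (\<lambda>_. 1) (UNIV :: 'n set) * L2_set (\<lambda>i. x $ i - y $ i) UNIV"
    by (rule L2_set_mult_ineq)
  also have "\<dots> = sqrt n * dist x y"
    by (simp add: L2_set_def n_def dist_vec_def dist_real_def)
  finally have "\<bar>(\<Sum>i\<in>UNIV. f (x $ i)) - (\<Sum>i\<in>UNIV. f (y $ i))\<bar> \<le> L * (sqrt n * dist x y)"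
    using L by (simp add: mult_left_mono)
  then have "dist (empirical_mean f x) (empirical_mean f y) \<le> L * (sqrt n * dist x y) / n"
    using n by (simp add: dist_real_def empirical_mean_def n_def[symmetric] diff_divide_distrib[symmetric]
        divide_right_mono)
  also have "\<dots> = L / sqrt n * dist x y"
  proof -
    define m where "m = sqrt n"
    have m: "m > 0" "n = m * m" using n by (simp_all add: m_def)
    show ?thesis unfolding m_def[symmetric] using m by (simp add: field_simps)
  qed
  finally show "dist (empirical_mean f x) (empirical_mean f y) \<le> L / sqrt (real CARD('n)) * dist x y"
    by (simp add: n_def)
qed

context strongly_log_concave_prob
begin

text \<open>
  A constant of \<open>0\<close> forces \<open>F\<close> to be constant, and then the deviation event is empty, in accordance with
  the convention for the exponential.
\<close>

lemma concentration_gauss_exp: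
  fixes F :: "'a \<Rightarrow> real"
  assumes F: "C-lipschitz_on UNIV F" and r: "r > 0"
  shows "prob {x. \<bar>F x - expectation F\<bar> \<ge> r} \<le> 2 * gauss_exp \<rho> (ennreal C) r"
proof (cases "C = 0")
  case True
  have "F = (\<lambda>_. F 0)" using lipschitz_onD[OF F, of _ 0] True by auto
  then obtain c where "F = (\<lambda>_. c)" by metis
  then have "{x. \<bar>F x - expectation F\<bar> \<ge> r} = {}" using r by (simp add: prob_UNIV)
  then show ?thesis using True by (simp add: gauss_exp_def)
next
  case False
  then have "C > 0" using lipschitz_on_nonneg[OF F] by simp
  then show ?thesis using concentration[OF F _ r] by (simp add: gauss_exp_def)
qed

lemma concentration_lip_norm:
  fixes F :: "'a \<Rightarrow> real"
  assumes "r > 0"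
  shows "prob {x. \<bar>F x - expectation F\<bar> \<ge> r} \<le> 2 * gauss_exp \<rho> (lip_norm F) r"
proof (cases "lip_norm F = \<infinity>")
  case True
  then show ?thesis by (simp add: gauss_exp_def order_trans[OF prob_le_1])
next
  case False
  then obtain L where "L \<ge> 0" "lip_norm F = ennreal L" "L-lipschitz_on UNIV F"
    by (rule lip_norm_attained)
  then show ?thesis using concentration_gauss_exp[of L F r] assms by simp
qed

end

section \<open>Gibbs measures on the Weyl chamber\<close>

definition chamber :: "(real ^ 'n::{finite,linorder}) set" where
  "chamber = {x. \<forall>i j. i < j \<longrightarrow> x $ j < x $ i}"

text \<open>
  The real-valued form of \<open>exp (- U)\<close>, with the interaction \<open>W\<close> replaced by its finite values \<open>w\<close> on the
  positive half-line; the infinite values of \<open>W\<close> are encoded by the restriction to the chamber.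
\<close>

definition gibbs_weight ::
  "(real ^ 'n::{finite,linorder} \<Rightarrow> real) \<Rightarrow> (real \<Rightarrow> real) \<Rightarrow> real ^ 'n::{finite,linorder} \<Rightarrow> real" where
  "gibbs_weight V w x =
     (if x \<in> chamber then exp (- (V x + (\<Sum>(i, j)\<in>{(i, j). i < j}. w (x $ i - x $ j)))) else 0)"

lemma exp_neg_energy:
  fixes V :: "real ^ 'n::{finite,linorder} \<Rightarrow> real"
  assumes pos: "\<And>u. u > 0 \<Longrightarrow> W u = ereal (w u)" and neg: "\<And>u. u \<le> 0 \<Longrightarrow> W u = \<infinity>"
  shows "exp_neg (energy V W x) = ennreal (gibbs_weight V w x)"
proof (cases "x \<in> chamber")
  case True
  have "(\<Sum>(i, j)\<in>{(i::'n, j). i < j}. W (x $ i - x $ j)) =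
      (\<Sum>(i, j)\<in>{(i::'n, j). i < j}. ereal (w (x $ i - x $ j)))"
    using True by (intro sum.cong) (auto simp: chamber_def pos)
  also have "\<dots> = ereal (\<Sum>(i, j)\<in>{(i::'n, j). i < j}. w (x $ i - x $ j))"
    by (simp add: case_prod_beta)
  finally show ?thesis using True by (simp add: energy_def exp_neg_def gibbs_weight_def)
next
  case False
  then obtain i j where "i < j" "x $ i - x $ j \<le> 0" by (auto simp: chamber_def not_less)
  then have "\<exists>p\<in>{(i::'n, j). i < j}. (case p of (i, j) \<Rightarrow> W (x $ i - x $ j)) = \<infinity>"
    using neg by (intro bexI[of _ "(i, j)"]) auto
  then have "(\<Sum>(i, j)\<in>{(i::'n, j). i < j}. W (x $ i - x $ j)) = \<infinity>"
    unfolding sum_Pinfty by simp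
  then show ?thesis using False by (simp add: energy_def exp_neg_def gibbs_weight_def)
qed

lemma open_chamber: "open (chamber :: (real ^ 'n::{finite,linorder}) set)"
proof -
  have "chamber = (\<Inter>(i, j)\<in>{(i::'n, j). i < j}. {x :: (real, 'n) vec. x $ j < x $ i})"
    by (auto simp: chamber_def)
  also have "open \<dots>"
    by (intro open_INT ballI) (auto intro!: open_Collect_less continuous_intros)
  finally show ?thesis .
qed

lemma chamber_nonempty: "(chamber :: (real ^ 'n::{finite,linorder}) set) \<noteq> {}"
proof -
  \<comment> \<open>The number of larger indices is a strictly decreasing function of the index.\<close>
  have "card {k. j < k} < card {k::'n. i < k}" if "i < j" for i j
    using that by (intro psubset_card_mono) (auto dest: less_trans)
  then have "(\<chi> i. real (card {k::'n. i < k})) \<in> chamber" by (simp add: chamber_def)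
  then show ?thesis by blast
qed

lemma real_part_of_interaction:
  fixes W :: "real \<Rightarrow> ereal"
  assumes W: "ext_convex W" "{u. W u < \<infinity>} = {0<..}"
  defines "w \<equiv> \<lambda>u. real_of_ereal (W u)"
  shows "\<And>u. u > 0 \<Longrightarrow> W u = ereal (w u)" "\<And>u. u \<le> 0 \<Longrightarrow> W u = \<infinity>" "convex_on {0<..} w"
proof -
  have fin: "W u < \<infinity> \<longleftrightarrow> u > 0" for u using W(2) by auto
  show pos: "W u = ereal (w u)" if "u > 0" for u
    using fin[of u] that W(1) unfolding w_def ext_convex_def by (cases "W u") auto
  show "W u = \<infinity>" if "u \<le> 0" for u
    using fin[of u] that by auto
  show "convex_on {0<..} w"
  proof (rule convex_onI)
    fix t x y :: real
    assume t: "0 < t" "t < 1" and xy: "x \<in> {0<..}" "y \<in> {0<..}"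
    have "(1 - t) * x + t * y > 0" using t xy by (intro add_pos_pos mult_pos_pos) auto
    moreover have "W ((1 - t) *\<^sub>R x + t *\<^sub>R y) \<le> ereal (1 - t) * W x + ereal t * W y"
      using W(1) t unfolding ext_convex_def by auto
    ultimately show "w ((1 - t) *\<^sub>R x + t *\<^sub>R y) \<le> (1 - t) * w x + t * w y"
      using xy by (simp add: pos)
  qed simp
qed

lemma rho_convex_real:
  assumes "rho_convex \<rho> (\<lambda>x. ereal (V x))"
  shows "convex_on UNIV (\<lambda>x. V x - \<rho> * (norm x)\<^sup>2 / 2)"
  using assms unfolding rho_convex_def ext_convex_def by (intro convex_onI) auto

lemma norm_convex_combination:
  fixes x y :: "'a::real_inner"
  shows "(norm (t *\<^sub>R x + (1 - t) *\<^sub>R y))\<^sup>2 =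
    t * (norm x)\<^sup>2 + (1 - t) * (norm y)\<^sup>2 - t * (1 - t) * (norm (x - y))\<^sup>2"
  unfolding power2_norm_eq_inner
  by (simp add: inner_commute algebra_simps power2_eq_square)

text \<open>
  The chamber is convex, and on it the interaction is a sum of convex functions composed with the
  linear forms \<open>x\<^sub>i - x\<^sub>j\<close>. The quadratic gain comes from \<open>V\<close> alone, through the expansion of
  \<open>|t x + (1 - t) y|\<^sup>2\<close>.
\<close>

lemma gibbs_weight_strongly_log_concave:
  fixes V :: "real ^ 'n::{finite,linorder} \<Rightarrow> real"
  assumes V: "convex_on UNIV (\<lambda>x. V x - \<rho> * (norm x)\<^sup>2 / 2)" and w: "convex_on {0<..} w"
  shows "strongly_log_concave \<rho> (gibbs_weight V w)"
  unfolding strongly_log_concave_def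
proof (intro conjI allI ballI)
  show "0 \<le> gibbs_weight V w x" for x by (simp add: gibbs_weight_def)
  fix x y :: "(real, 'n) vec" and t :: real
  assume "t \<in> {0<..<1}"
  then have t: "0 < t" "t < 1" by auto
  define z where "z = t *\<^sub>R x + (1 - t) *\<^sub>R y"
  show "gibbs_weight V w x powr t * gibbs_weight V w y powr (1 - t) *
      exp (\<rho> * t * (1 - t) / 2 * (norm (x - y))\<^sup>2) \<le> gibbs_weight V w (t *\<^sub>R x + (1 - t) *\<^sub>R y)"
  proof (cases "x \<in> chamber \<and> y \<in> chamber")
    case True
    define S where "S = (\<lambda>x :: (real, 'n) vec. \<Sum>(i, j)\<in>{(i, j). i < j}. w (x $ i - x $ j))"
    have "z $ j < z $ i" if "i < j" for i j
      using True that t unfolding z_def chamber_def by (simp add: add_strict_mono)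
    then have z: "z \<in> chamber" by (simp add: chamber_def)
    have "V z - \<rho> * (norm z)\<^sup>2 / 2 \<le>
        t * (V x - \<rho> * (norm x)\<^sup>2 / 2) + (1 - t) * (V y - \<rho> * (norm y)\<^sup>2 / 2)"
      using convex_onD[OF V, of "1 - t" x y] t by (simp add: z_def)
    then have Vz: "V z \<le> t * V x + (1 - t) * V y - \<rho> * t * (1 - t) / 2 * (norm (x - y))\<^sup>2"
      unfolding z_def norm_convex_combination by (simp add: field_simps)
    have "S z \<le> (\<Sum>(i, j)\<in>{(i, j). i < j}. t * w (x $ i - x $ j) + (1 - t) * w (y $ i - y $ j))"
      unfolding S_def
    proof (rule sum_mono, clarify)
      fix i j :: 'n assume "i < j"
      then have "w ((1 - (1 - t)) *\<^sub>R (x $ i - x $ j) + (1 - t) *\<^sub>R (y $ i - y $ j))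
          \<le> (1 - (1 - t)) * w (x $ i - x $ j) + (1 - t) * w (y $ i - y $ j)"
        using True t by (intro convex_onD[OF w]) (auto simp: chamber_def)
      moreover have "(1 - (1 - t)) *\<^sub>R (x $ i - x $ j) + (1 - t) *\<^sub>R (y $ i - y $ j) = z $ i - z $ j"
        by (simp add: z_def algebra_simps)
      ultimately show "w (z $ i - z $ j) \<le> t * w (x $ i - x $ j) + (1 - t) * w (y $ i - y $ j)" by simp
    qed
    also have "\<dots> = t * S x + (1 - t) * S y"
      unfolding S_def by (simp add: case_prod_beta sum.distrib sum_distrib_left)
    finally have "t * (- (V x + S x)) + (1 - t) * (- (V y + S y)) + \<rho> * t * (1 - t) / 2 * (norm (x - y))\<^sup>2
        \<le> - (V z + S z)"
      using Vz by (simp add: algebra_simps)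
    moreover have "gibbs_weight V w u = exp (- (V u + S u))" if "u \<in> chamber" for u
      using that by (simp add: gibbs_weight_def S_def)
    ultimately show ?thesis
      using True z unfolding z_def[symmetric] by (simp add: powr_def exp_add[symmetric] mult.commute)
  next
    case False
    then have "gibbs_weight V w x = 0 \<or> gibbs_weight V w y = 0" by (auto simp: gibbs_weight_def)
    then show ?thesis by (auto simp: gibbs_weight_def)
  qed
qed

text \<open>
  Finite convex functions on open convex sets are continuous, so the weight is continuous on the open
  chamber and vanishes outside of it.
\<close>

lemma gibbs_weight_measurable:
  fixes V :: "real ^ 'n::{finite,linorder} \<Rightarrow> real"
  assumes V: "convex_on UNIV (\<lambda>x. V x - \<rho> * (norm x)\<^sup>2 / 2)" and w: "convex_on {0<..} w"
  shows "gibbs_weight V w \<in> borel_measurable borel"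
proof -
  have "continuous_on UNIV (\<lambda>x. (V x - \<rho> * (norm x)\<^sup>2 / 2) + \<rho> * (norm x)\<^sup>2 / 2)"
    by (intro continuous_on_add convex_on_continuous V continuous_intros) auto
  then have cV: "continuous_on chamber V" by (auto intro: continuous_on_subset)
  have cw: "continuous_on {0<..} w" by (intro convex_on_continuous w) auto
  have "continuous_on chamber (\<lambda>x. exp (- (V x + (\<Sum>(i, j)\<in>{(i, j). i < j}. w (x $ i - x $ j)))))"
    unfolding split_def
    by (intro continuous_intros cV continuous_on_compose2[OF cw]) (auto simp: chamber_def)
  then show ?thesis
    unfolding gibbs_weight_def[abs_def]
    by (intro borel_measurable_continuous_on_if) (auto intro!: borel_open open_chamber)
qed

text \<open>
  The weight is positive on a nonempty open set, so that the normalization is meaningful.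
\<close>

lemma gibbs_weight_positive_mass:
  fixes V :: "real ^ 'n::{finite,linorder} \<Rightarrow> real"
  assumes [measurable]: "gibbs_weight V w \<in> borel_measurable borel"
  shows "(\<integral>\<^sup>+x. ennreal (gibbs_weight V w x) \<partial>lborel) \<noteq> 0"
proof
  assume "(\<integral>\<^sup>+x. ennreal (gibbs_weight V w x) \<partial>lborel) = 0"
  then have "AE x in lborel. ennreal (gibbs_weight V w x) = 0"
    by (subst (asm) nn_integral_0_iff_AE) auto
  then have "AE x in lborel. x \<notin> (chamber :: ((real, 'n) vec) set)"
    by (rule AE_mp) (auto simp: gibbs_weight_def ennreal_eq_0_iff)
  then have "(chamber :: ((real, 'n) vec) set) \<in> null_sets lborel"
    using borel_open[OF open_chamber] by (subst (asm) AE_iff_null_sets[symmetric]) auto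
  then have "negligible (chamber :: ((real, 'n) vec) set)"
    by (simp add: negligible_iff_null_sets null_sets_completionI)
  then show False using open_not_negligible[OF open_chamber chamber_nonempty] by blast
qed

lemma gibbs_strongly_log_concave:
  fixes V :: "real ^ 'n::{finite,linorder} \<Rightarrow> real"
  assumes "gibbs_setting \<rho> V W"
  obtains q where "strongly_log_concave_prob q \<rho>" "gibbs V W = strongly_log_concave_prob.\<mu> q"
proof -
  define w where "w u = real_of_ereal (W u)" for u
  have \<rho>: "\<rho> > 0" and Z: "partition_fn V W < \<infinity>"
    and V: "convex_on UNIV (\<lambda>x. V x - \<rho> * (norm x)\<^sup>2 / 2)"
    using assms by (auto simp: gibbs_setting_def intro: rho_convex_real)
  have W: "ext_convex W" "{u. W u < \<infinity>} = {0<..}"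
    using assms by (auto simp: gibbs_setting_def)
  note w = real_part_of_interaction[OF W, folded w_def]
  define p where "p = gibbs_weight V w"
  have p: "exp_neg (energy V W x) = ennreal (p x)" for x
    unfolding p_def by (rule exp_neg_energy) (fact w)+
  have [measurable]: "p \<in> borel_measurable borel"
    unfolding p_def by (rule gibbs_weight_measurable[OF V w(3)])
  have slc: "strongly_log_concave \<rho> p"
    unfolding p_def by (rule gibbs_weight_strongly_log_concave[OF V w(3)])
  have "partition_fn V W \<noteq> 0"
    unfolding partition_fn_def p p_def by (rule gibbs_weight_positive_mass) (simp add: p_def[symmetric])
  with Z obtain z where z: "partition_fn V W = ennreal z" "z > 0"
    by (cases "partition_fn V W") (auto simp: ennreal_eq_0_iff)
  have q: "exp_neg (energy V W x) / partition_fn V W = ennreal (p x / z)" for x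
    using slc z by (simp add: p divide_ennreal strongly_log_concave_def)
  have prob: "strongly_log_concave_prob (\<lambda>x. p x / z) \<rho>"
  proof
    show "strongly_log_concave \<rho> (\<lambda>x. p x / z)"
      unfolding strongly_log_concave_def
    proof (intro conjI allI ballI)
      show "0 \<le> p x / z" for x using slc z by (simp add: strongly_log_concave_def)
      fix x y :: "(real, 'n) vec" and t :: real
      assume t: "t \<in> {0<..<1}"
      define e where "e = exp (\<rho> * t * (1 - t) / 2 * (norm (x - y))\<^sup>2)"
      have "z powr t * z powr (1 - t) = z" using z by (simp add: powr_add[symmetric])
      then have "(p x / z) powr t * (p y / z) powr (1 - t) * e = (p x powr t * p y powr (1 - t) * e) / z"
        by (simp add: powr_divide)
      also have "\<dots> \<le> p (t *\<^sub>R x + (1 - t) *\<^sub>R y) / z"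
        using slc t z by (intro divide_right_mono) (auto simp: strongly_log_concave_def e_def)
      finally show "(p x / z) powr t * (p y / z) powr (1 - t) *
          exp (\<rho> * t * (1 - t) / 2 * (norm (x - y))\<^sup>2) \<le> p (t *\<^sub>R x + (1 - t) *\<^sub>R y) / z"
        by (simp add: e_def)
    qed
    have "(\<integral>\<^sup>+x. ennreal (p x / z) \<partial>lborel) = (\<integral>\<^sup>+x. ennreal (p x) / ennreal z \<partial>lborel)"
      using slc z by (simp add: divide_ennreal strongly_log_concave_def)
    also have "\<dots> = (\<integral>\<^sup>+x. ennreal (p x) \<partial>lborel) / ennreal z"
      by (rule nn_integral_divide) simp
    also have "(\<integral>\<^sup>+x. ennreal (p x) \<partial>lborel) = ennreal z"
      using z(1) by (simp add: partition_fn_def p)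
    finally show "(\<integral>\<^sup>+x. ennreal (p x / z) \<partial>lborel) = 1" using z by (simp add: divide_ennreal)
  qed (use \<rho> in measurable)
  show ?thesis
  proof (rule that[OF prob])
    show "gibbs V W = strongly_log_concave_prob.\<mu> (\<lambda>x. p x / z)"
      using prob by (simp add: strongly_log_concave_prob.\<mu>_def gibbs_def q)
  qed
qed

lemma gibbs_concentration:
  fixes V :: "real ^ 'n::{finite,linorder} \<Rightarrow> real"
  assumes "gibbs_setting \<rho> V W"
  shows "prob_space (gibbs V W)"
    and "\<And>F :: real ^ 'n::{finite,linorder} \<Rightarrow> real. \<exists>C. C-lipschitz_on UNIV F \<Longrightarrow> integrable (gibbs V W) F"
    and "\<And>(F :: real ^ 'n::{finite,linorder} \<Rightarrow> real) r. r > 0 \<Longrightarrow>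
      measure (gibbs V W) {x. \<bar>F x - (\<integral>y. F y \<partial>gibbs V W)\<bar> \<ge> r} \<le> 2 * gauss_exp \<rho> (lip_norm F) r"
    and "\<And>(f :: real \<Rightarrow> real) r. r > 0 \<Longrightarrow>
      measure (gibbs V W) {x. \<bar>empirical_mean f x - (\<integral>y. empirical_mean f y \<partial>gibbs V W)\<bar> \<ge> r}
        \<le> 2 * gauss_exp (real CARD('n) * \<rho>) (lip_norm f) r"
    and "\<And>k r. r > 0 \<Longrightarrow>
      measure (gibbs V W) {x. \<bar>x $ k - (\<integral>y. y $ k \<partial>gibbs V W)\<bar> \<ge> r} \<le> 2 * exp (- (\<rho> * (r\<^sup>2 / 2)))"
proof -
  obtain q where q: "strongly_log_concave_prob q \<rho>" and eq: "gibbs V W = strongly_log_concave_prob.\<mu> q"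
    using gibbs_strongly_log_concave[OF assms] .
  interpret strongly_log_concave_prob q \<rho> by (rule q)
  show "prob_space (gibbs V W)" unfolding eq by (rule prob_space_axioms)
  show "integrable (gibbs V W) F" if "\<exists>C. C-lipschitz_on UNIV F" for F :: "(real, 'n) vec \<Rightarrow> real"
    unfolding eq using that lipschitz_integrable by blast
  show "measure (gibbs V W) {x. \<bar>F x - (\<integral>y. F y \<partial>gibbs V W)\<bar> \<ge> r} \<le> 2 * gauss_exp \<rho> (lip_norm F) r"
    if "r > 0" for r and F :: "(real, 'n) vec \<Rightarrow> real"
    unfolding eq using that by (rule concentration_lip_norm)
  show "measure (gibbs V W) {x. \<bar>x $ k - (\<integral>y. y $ k \<partial>gibbs V W)\<bar> \<ge> r} \<le> 2 * exp (- (\<rho> * (r\<^sup>2 / 2)))"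
    if "r > 0" for r k
    unfolding eq using concentration[OF lipschitz_on_component[of k] _ that] by simp
  show "measure (gibbs V W) {x. \<bar>empirical_mean f x - (\<integral>y. empirical_mean f y \<partial>gibbs V W)\<bar> \<ge> r}
        \<le> 2 * gauss_exp (real CARD('n) * \<rho>) (lip_norm f) r"
    if r: "r > 0" for r and f :: "real \<Rightarrow> real"
  proof (cases "lip_norm f = \<infinity>")
    case True
    then show ?thesis by (simp add: gauss_exp_def eq order_trans[OF prob_le_1])
  next
    case False
    then obtain L where L: "L \<ge> 0" "lip_norm f = ennreal L" "L-lipschitz_on UNIV f"
      by (rule lip_norm_attained)
    show ?thesis
      unfolding eq using concentration_gauss_exp[OF lipschitz_on_empirical_mean[OF L(3)] r] L
      by (simp add: gauss_exp_rescale)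
  qed
qed

section \<open>The beta Hermite ensemble\<close>

lemma gaussian_integral_finite:
  "(\<integral>\<^sup>+x. ennreal (exp (- (norm x)\<^sup>2 / 4)) \<partial>(lborel :: 'a::euclidean_space measure)) < \<infinity>"
proof -
  have "(\<integral>\<^sup>+x. ennreal (exp (- x\<^sup>2 / 4)) \<partial>(lborel :: real measure)) < \<infinity>"
  proof -
    \<comment> \<open>\<open>exp (- x\<^sup>2 / 4)\<close> is an unnormalized Gaussian density with variance \<open>2\<close>.\<close>
    have "integrable lborel (\<lambda>x. sqrt (4 * pi) * normal_density 0 (sqrt 2) x)"
      by (intro integrable_mult_right integrable_normal_density) simp
    then have "integrable lborel (\<lambda>x::real. exp (- x\<^sup>2 / 4))"
      by (simp add: normal_density_def)
    then show ?thesis by (simp add: integrable_iff_bounded)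
  qed
  moreover have "(\<integral>\<^sup>+x. ennreal (exp (- (norm x)\<^sup>2 / 4)) \<partial>(lborel :: 'a measure)) =
      (\<integral>\<^sup>+x. (\<Prod>b\<in>Basis. ennreal (exp (- (x \<bullet> b)\<^sup>2 / 4))) \<partial>(lborel :: 'a measure))"
  proof (intro nn_integral_cong)
    fix x :: 'a
    have "(norm x)\<^sup>2 = (\<Sum>b\<in>Basis. (x \<bullet> b)\<^sup>2)"
      unfolding power2_norm_eq_inner by (subst euclidean_inner) (simp add: power2_eq_square)
    then show "ennreal (exp (- (norm x)\<^sup>2 / 4)) = (\<Prod>b\<in>Basis. ennreal (exp (- (x \<bullet> b)\<^sup>2 / 4)))"
      by (simp add: prod_ennreal exp_sum[symmetric] sum_negf sum_divide_distrib)
  qed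
  moreover have "\<dots> = (\<Prod>b\<in>(Basis :: 'a set). (\<integral>\<^sup>+x. ennreal (exp (- x\<^sup>2 / 4)) \<partial>lborel))"
    by (rule nn_integral_lborel_prod) auto
  ultimately show ?thesis by (simp add: power_less_top_ennreal)
qed

text \<open>
  Finiteness of the partition function is the only substantial point. Since \<open>ln u \<le> u\<close>, the interaction
  contributes at most \<open>B |x|\<close> to the exponent, where \<open>B\<close> is \<open>2 \<beta>\<close> times the number of pairs, and
  \<open>B |x| \<le> B\<^sup>2 + |x|\<^sup>2 / 4\<close>. As the confinement is at least \<open>|x|\<^sup>2 / 2\<close>, the weight is
  dominated by a multiple of \<open>exp (- |x|\<^sup>2 / 4)\<close>.
\<close>

lemma hermite_setting:
  assumes \<beta>: "\<beta> > 0"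
  shows "gibbs_setting (real CARD('n)) (hermite_V :: real ^ 'n::{finite,linorder} \<Rightarrow> real) (hermite_W \<beta>)"
proof -
  define P where "P = real (card {(i::'n, j). i < j})"
  define B where "B = 2 * \<beta> * P"
  have "exp_neg (energy hermite_V (hermite_W \<beta>) x) \<le> ennreal (exp (B\<^sup>2)) * ennreal (exp (- (norm x)\<^sup>2 / 4))"
    for x :: "(real, 'n) vec"
  proof -
    define S where "S = (\<Sum>(i, j)\<in>{(i::'n, j). i < j}. - \<beta> * ln (x $ i - x $ j))"
    have "gibbs_weight hermite_V (\<lambda>u. - \<beta> * ln u) x \<le> exp (B\<^sup>2 - (norm x)\<^sup>2 / 4)"
    proof (cases "x \<in> chamber")
      case True
      have "- S = (\<Sum>(i, j)\<in>{(i::'n, j). i < j}. \<beta> * ln (x $ i - x $ j))"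
        by (simp add: S_def case_prod_beta sum_negf)
      also have "\<dots> \<le> (\<Sum>(i, j)\<in>{(i::'n, j). i < j}. \<beta> * (2 * norm x))"
      proof (rule sum_mono, clarify)
        fix i j :: 'n assume "i < j"
        then have "0 < x $ i - x $ j" using True by (simp add: chamber_def)
        from ln_le_minus_one[OF this] have "ln (x $ i - x $ j) \<le> x $ i - x $ j" by simp
        also have "\<dots> \<le> 2 * norm x"
          using component_le_norm_cart[of x i] component_le_norm_cart[of x j] by (simp add: abs_le_iff)
        finally show "\<beta> * ln (x $ i - x $ j) \<le> \<beta> * (2 * norm x)" using \<beta> by (intro mult_left_mono) auto
      qed
      also have "\<dots> = B * norm x" by (simp add: case_prod_beta B_def P_def)
      also have "\<dots> \<le> B\<^sup>2 + (norm x)\<^sup>2 / 4"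
        using zero_le_power2[of "B - norm x / 2"] by (simp add: power2_eq_square algebra_simps)
      finally have S: "- S \<le> B\<^sup>2 + (norm x)\<^sup>2 / 4" .
      have "1 \<le> real CARD('n)" by (simp add: Suc_le_eq)
      then have "1 * (norm x)\<^sup>2 \<le> real CARD('n) * (norm x)\<^sup>2" by (rule mult_right_mono) simp
      then have "- (hermite_V x + S) \<le> B\<^sup>2 - (norm x)\<^sup>2 / 4" using S by (simp add: hermite_V_def)
      then show ?thesis using True by (simp add: gibbs_weight_def S_def)
    qed (simp add: gibbs_weight_def)
    moreover have "exp_neg (energy hermite_V (hermite_W \<beta>) x) = ennreal (gibbs_weight hermite_V (\<lambda>u. - \<beta> * ln u) x)"
      by (rule exp_neg_energy) (auto simp: hermite_W_def)
    ultimately show ?thesis by (simp add: ennreal_mult[symmetric] exp_add[symmetric] ennreal_leI)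
  qed
  then have "partition_fn (hermite_V :: (real, 'n) vec \<Rightarrow> real) (hermite_W \<beta>) \<le>
      (\<integral>\<^sup>+x. ennreal (exp (B\<^sup>2)) * ennreal (exp (- (norm (x :: (real, 'n) vec))\<^sup>2 / 4)) \<partial>lborel)"
    unfolding partition_fn_def by (intro nn_integral_mono)
  also have "\<dots> = ennreal (exp (B\<^sup>2)) * (\<integral>\<^sup>+x. ennreal (exp (- (norm (x :: (real, 'n) vec))\<^sup>2 / 4)) \<partial>lborel)"
    by (rule nn_integral_cmult) simp
  also have "\<dots> < \<infinity>"
    using gaussian_integral_finite[where 'a="(real, 'n) vec"] by (simp add: ennreal_mult_less_top)
  finally have Z: "partition_fn (hermite_V :: (real, 'n) vec \<Rightarrow> real) (hermite_W \<beta>) < \<infinity>" .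
  have "ext_convex (hermite_W \<beta>)"
    unfolding ext_convex_def
  proof (intro conjI allI ballI)
    show "hermite_W \<beta> x \<noteq> - \<infinity>" for x by (simp add: hermite_W_def)
    fix x y t :: real assume "t \<in> {0<..<1}"
    then have t: "0 < t" "t < 1" by auto
    show "hermite_W \<beta> ((1 - t) *\<^sub>R x + t *\<^sub>R y) \<le> ereal (1 - t) * hermite_W \<beta> x + ereal t * hermite_W \<beta> y"
    proof (cases "x > 0 \<and> y > 0")
      case True
      have "(1 - t) * ln x + t * ln y \<le> ln ((1 - t) * x + t * y)"
        using ln_concave True t unfolding concave_on_iff by auto
      then have "\<beta> * ((1 - t) * ln x + t * ln y) \<le> \<beta> * ln ((1 - t) * x + t * y)"
        using \<beta> by (intro mult_left_mono) auto
      moreover have "(1 - t) * x + t * y > 0" using True t by (intro add_pos_pos mult_pos_pos) auto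
      ultimately show ?thesis using True by (simp add: hermite_W_def algebra_simps)
    next
      case False
      then show ?thesis using t by (auto simp: hermite_W_def)
    qed
  qed
  moreover have "{u. hermite_W \<beta> u < \<infinity>} = {0<..}" by (auto simp: hermite_W_def)
  moreover have "rho_convex (real CARD('n)) (\<lambda>x :: (real, 'n) vec. ereal (hermite_V x))"
    by (simp add: rho_convex_def ext_convex_def hermite_V_def)
  ultimately show ?thesis using Z by (simp add: gibbs_setting_def)
qed

section \<open>Concentration for Gibbs measures and the beta Hermite ensemble\<close>

theorem corollary1p4:
  shows
    "(\<forall>(\<rho>::real) (V :: real ^ 'n::{finite,linorder} \<Rightarrow> real) (W :: real \<Rightarrow> ereal).
        gibbs_setting \<rho> V W \<longrightarrow>
        (let \<mu> = gibbs V W in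
          prob_space \<mu> \<and>
          (\<forall>F :: real ^ 'n::{finite,linorder} \<Rightarrow> real. (\<exists>C. C-lipschitz_on UNIV F) \<longrightarrow>
             integrable \<mu> F \<and>
             (\<forall>r>0. measure \<mu> {x. \<bar>F x - (\<integral>y. F y \<partial>\<mu>)\<bar> \<ge> r}
                      \<le> 2 * gauss_exp \<rho> (lip_norm F) r)) \<and>
          (\<forall>f\<in>borel_measurable borel. \<forall>r>0.
             measure \<mu> {x. \<bar>empirical_mean f x - (\<integral>y. empirical_mean f y \<partial>\<mu>)\<bar> \<ge> r}
               \<le> 2 * gauss_exp (real CARD('n) * \<rho>) (lip_norm f) r) \<and>
          (\<forall>r>0.
             measure \<mu> {x. \<bar>x $ Min UNIV - (\<integral>y. y $ Min UNIV \<partial>\<mu>)\<bar> \<ge> r}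
               \<le> 2 * exp (- (\<rho> * (r\<^sup>2 / 2)))))) \<and>
     (\<forall>\<beta>::real. \<beta> > 0 \<longrightarrow>
        gibbs_setting (real CARD('n)) (hermite_V :: real ^ 'n::{finite,linorder} \<Rightarrow> real) (hermite_W \<beta>) \<and>
        (let \<mu> = gibbs (hermite_V :: real ^ 'n::{finite,linorder} \<Rightarrow> real) (hermite_W \<beta>) in
          prob_space \<mu> \<and>
          (\<forall>F :: real ^ 'n::{finite,linorder} \<Rightarrow> real. (\<exists>C. C-lipschitz_on UNIV F) \<longrightarrow>
             integrable \<mu> F \<and>
             (\<forall>r>0. measure \<mu> {x. \<bar>F x - (\<integral>y. F y \<partial>\<mu>)\<bar> \<ge> r}
                      \<le> 2 * gauss_exp (real CARD('n)) (lip_norm F) r)) \<and>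
          (\<forall>f\<in>borel_measurable borel. \<forall>r>0.
             measure \<mu> {x. \<bar>empirical_mean f x - (\<integral>y. empirical_mean f y \<partial>\<mu>)\<bar> \<ge> r}
               \<le> 2 * gauss_exp (real CARD('n) * real CARD('n)) (lip_norm f) r) \<and>
          (\<forall>r>0.
             measure \<mu> {x. \<bar>x $ Min UNIV - (\<integral>y. y $ Min UNIV \<partial>\<mu>)\<bar> \<ge> r}
               \<le> 2 * exp (- (real CARD('n) * (r\<^sup>2 / 2))))))"
  unfolding Let_def
  by (intro conjI allI impI ballI;
      (rule hermite_setting | rule gibbs_concentration[OF hermite_setting] | rule gibbs_concentration);
      assumption)

end
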